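(* Let $f\in\mathcal W^{2p\times2p}$ be rational, bicomplex $\sharp$-symmetric, and taking strictly positive values on the unit circle ($f(e^{it})>0$ for all $t\in[0,2\pi]$). Then $f$ admits rational bicomplex $\sharp$-symmetric left and right spectral factorizations: there are rational bicomplex $\sharp$-symmetric functions $f_+,g_+$ with $f_+^{\pm1},g_+^{\pm1}\in\mathcal W_+^{2p\times2p}$ and $f_-,g_-$ with $f_-^{\pm1},g_-^{\pm1}\in\mathcal W_-^{2p\times2p}$ such that $f=f_-f_+$ (right) and $f=g_+g_-$ (left).
   Context: $\mathcal W^{2p\times2p}$ consists of the functions $f(e^{it})=\sum_{n\in\mathbb Z}f_ne^{int}$ with $f_n\in\mathbb C^{2p\times2p}$ and $\sum_n\|f_n\|<\infty$ (operator norm), with pointwise multiplication; $\mathcal W_+^{2p\times2p}$ (resp. $\mathcal W_-^{2p\times2p}$) is the subalgebra of those $f$ with $f_n=0$ for $n<0$ (resp. $n>0$). $f(e^{it})>0$ means that the matrix is positive definite. Let $J=\begin{pmatrix}0&-1\\1&0\end{pmatrix}$ and $J_p=J\otimes I_p$ (Kronecker product). For $M\in\mathbb C^{2p\times2p}$ put $M^\sharp=J_pMJ_p^*$. A function $f\in\mathcal W^{2p\times2p}$ is bicomplex $\sharp$-symmetric if $f(e^{it})=(f(e^{it}))^\sharp$ for all $t\in[0,2\pi]$. An element of $\mathcal W^{2p\times 2p}$ is rational if it is the restriction to the unit circle of a rational matrix-valued function. *)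

theory Defs
  imports "HOL-Analysis.Analysis" "HOL-Computational_Algebra.Polynomial"
begin

definition mat_adjoint :: "complex ^ 'n ^ 'm \<Rightarrow> complex ^ 'm ^ 'n" where
  "mat_adjoint A = (\<chi> i j. cnj (A $ j $ i))"

definition pos_def :: "complex ^ 'n ^ 'n \<Rightarrow> bool" where
  "pos_def A \<longleftrightarrow> mat_adjoint A = A \<and>
     (\<forall>x. x \<noteq> 0 \<longrightarrow> 0 < Re (\<Sum>i\<in>UNIV. cnj (x $ i) * (A *v x) $ i))"

text \<open>A block matrix with \<open>2 \<times> 2\<close> blocks of size \<open>p \<times> p\<close> has the pairs (block index, index
  within the block) as its row and column indices, so \<open>2p \<times> 2p\<close> matrices are those with index
  type \<^typ>\<open>2 \<times> 'p\<close>.\<close>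

definition kronecker :: "'a::times ^ 'n ^ 'm \<Rightarrow> 'a ^ 'q ^ 'r \<Rightarrow> 'a ^ ('n \<times> 'q) ^ ('m \<times> 'r)" where
  "kronecker A B = (\<chi> i j. A $ fst i $ fst j * B $ snd i $ snd j)"

definition J :: "complex ^ 2 ^ 2" where
  "J = vector [vector [0, -1], vector [1, 0]]"

definition Jp :: "complex ^ (2 \<times> 'p::finite) ^ (2 \<times> 'p)" where
  "Jp = kronecker J (mat 1)"

definition sharp :: "complex ^ (2 \<times> 'p::finite) ^ (2 \<times> 'p) \<Rightarrow> complex ^ (2 \<times> 'p) ^ (2 \<times> 'p)" where
  "sharp M = Jp ** M ** mat_adjoint Jp"

text \<open>Functions on the unit circle are represented by functions on \<open>\<complex>\<close>; only their values on
  \<^term>\<open>sphere (0::complex) 1\<close> matter in what follows. In \<open>fourier_expansion\<close>,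
  \<^term>\<open>mat (z powi n)\<close> is the scalar matrix \<open>z\<^sup>n I\<close>.\<close>

definition fourier_expansion ::
  "(complex \<Rightarrow> complex ^ 'n ^ 'n) \<Rightarrow> (int \<Rightarrow> complex ^ 'n ^ 'n) \<Rightarrow> bool" where
  "fourier_expansion f c \<longleftrightarrow>
     (\<lambda>n. onorm ((*v) (c n))) summable_on UNIV \<and>
     (\<forall>z\<in>sphere 0 1. ((\<lambda>n. mat (z powi n) ** c n) has_sum f z) UNIV)"

definition wiener :: "(complex \<Rightarrow> complex ^ 'n ^ 'n) set" where
  "wiener = {f. \<exists>c. fourier_expansion f c}"

definition wiener_plus :: "(complex \<Rightarrow> complex ^ 'n ^ 'n) set" where
  "wiener_plus = {f. \<exists>c. fourier_expansion f c \<and> (\<forall>n<0. c n = 0)}"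

definition wiener_minus :: "(complex \<Rightarrow> complex ^ 'n ^ 'n) set" where
  "wiener_minus = {f. \<exists>c. fourier_expansion f c \<and> (\<forall>n>0. c n = 0)}"

text \<open>\<open>f\<^sup>\<plusminus>\<^sup>1 \<in> W\<close>; the inverse is taken pointwise on the circle, and \<^const>\<open>matrix_inv\<close> is
  only meaningful at invertible matrices.\<close>

definition with_inverse_in ::
  "(complex \<Rightarrow> complex ^ 'n ^ 'n) \<Rightarrow> (complex \<Rightarrow> complex ^ 'n ^ 'n) set \<Rightarrow> bool" where
  "with_inverse_in f W \<longleftrightarrow>
     f \<in> W \<and> (\<forall>z\<in>sphere 0 1. invertible (f z)) \<and> (\<lambda>z. matrix_inv (f z)) \<in> W"

definition bicomplex_sharp_symmetric ::
  "(complex \<Rightarrow> complex ^ (2 \<times> 'p::finite) ^ (2 \<times> 'p)) \<Rightarrow> bool" where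
  "bicomplex_sharp_symmetric f \<longleftrightarrow> (\<forall>z\<in>sphere 0 1. f z = sharp (f z))"

text \<open>Since the functions considered are finite on the circle, the entries of the rational
  matrix function have no poles there, i.e. their reduced denominators do not vanish.\<close>

definition rational_on_circle :: "(complex \<Rightarrow> complex ^ 'n ^ 'n) \<Rightarrow> bool" where
  "rational_on_circle f \<longleftrightarrow>
     (\<forall>i j. \<exists>P Q :: complex poly. \<forall>z\<in>sphere 0 1. poly Q z \<noteq> 0 \<and> f z $ i $ j = poly P z / poly Q z)"

end

theory Submission
  imports Defs "HOL-Complex_Analysis.Cauchy_Integral_Formula"
    "HOL-Computational_Algebra.Fundamental_Theorem_Algebra"
begin

text \<open>Being \<open>\<sharp>\<close>-symmetric means commuting with \<^const>\<open>Jp\<close>, whose eigenvalues are \<open>\<plusminus>\<i>\<close>. Hence \<open>f\<close> is the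
  orthogonal sum of two rational positive \<open>p \<times> p\<close> blocks, one on each eigenspace, and any
  factorizations of the blocks can be put together again to a \<open>\<sharp>\<close>-symmetric factorization of \<open>f\<close>.

  A positive rational matrix function \<open>F\<close> without symmetry is factored as follows. Symmetric Gaussian
  elimination, with square roots of the pivots provided by the scalar Fejer--Riesz theorem,
  yields \<open>F = G\<^sup>* G\<close> on the circle with \<open>G\<close> rational. Write \<open>G = M / q\<close> with a polynomial matrix \<open>M\<close>
  and a polynomial \<open>q\<close>. The zeros of \<open>det M\<close> in the disc are removed one after the other by
  multiplying \<open>M\<close> from the left with Blaschke--Potapov factors, which are unitary on the circle
  and so preserve \<open>M\<^sup>* M\<close>; the zeros of \<open>q\<close> are treated as the \<open>1 \<times> 1\<close> case. Then \<open>G\<close> and its inverse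
  are analytic in a neighbourhood of the closed disc, so that their Taylor series converge
  absolutely on the circle. The left factorization is the right one of the transpose.\<close>

section \<open>Rational functions on the circle\<close>

lemma infinite_unit_circle: "infinite (sphere (0::complex) 1)"
proof -
  have "inj_on cis {0..1}"
  proof (rule inj_onI)
    fix x y :: real
    assume "x \<in> {0..1}" "y \<in> {0..1}" "cis x = cis y"
    then have "cos x = cos y" "0 \<le> x" "x \<le> pi" "0 \<le> y" "y \<le> pi"
      using pi_gt3 by (auto simp: complex_eq_iff)
    then show "x = y"
      using cos_inj_pi by blast
  qed
  then have "infinite (cis ` {0..1})"
    by (simp add: finite_image_iff)
  moreover have "cis ` {0..1} \<subseteq> sphere 0 1"
    by auto
  ultimately show ?thesis
    using finite_subset by blast
qed

lemma poly_eqI_unit_circle: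
  fixes p q :: "complex poly"
  assumes "\<And>z. z \<in> sphere 0 1 \<Longrightarrow> poly p z = poly q z"
  shows "p = q"
proof (rule ccontr)
  assume "p \<noteq> q"
  then have "finite {z. poly (p - q) z = 0}"
    by (intro poly_roots_finite) simp
  moreover have "sphere 0 1 \<subseteq> {z. poly (p - q) z = 0}"
    using assms by auto
  ultimately show False
    using infinite_unit_circle finite_subset by blast
qed

lemma cnj_unit_circle:
  assumes "z \<in> sphere 0 1"
  shows "cnj z = inverse z"
proof -
  have "z * cnj z = 1"
    using assms by (simp add: complex_norm_square [symmetric])
  then show ?thesis
    by (metis inverse_unique)
qed

text \<open>On the circle \<open>cnj z\<close> is \<open>1 / z\<close>, so the conjugate of a
  polynomial is a polynomial in \<open>1 / z\<close>. This makes conjugation an algebraic operation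
  there.\<close>

lemma cnj_poly_unit_circle:
  assumes "z \<in> sphere 0 1"
  shows "cnj (poly p z) = poly (reflect_poly (map_poly cnj p)) z / z ^ degree p"
proof -
  have z: "z \<noteq> 0"
    using assms by auto
  have "poly (reflect_poly (map_poly cnj p)) z = z ^ degree p * poly (map_poly cnj p) (inverse z)"
    using z by (simp add: poly_reflect_poly_nz degree_map_poly)
  also have "poly (map_poly cnj p) (inverse z) = cnj (poly p z)"
    using cnj_unit_circle[OF assms] by (metis poly_cnj)
  finally show ?thesis
    using z by simp
qed

text \<open>Unimodularity of the Blaschke factor \<open>(1 - cnj a * z) / (z - a)\<close> on the
  circle, free of quotients. The removal of zeros rests on it.\<close>

lemma norm_unit_circle_reflect:
  assumes "z \<in> sphere 0 1"
  shows "(1 - cnj a * z) * cnj (1 - cnj a * z) = (z - a) * cnj (z - a)"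
proof -
  have "z * cnj z = 1"
    using assms by (simp add: complex_norm_square [symmetric])
  then show ?thesis
    by (simp add: algebra_simps)
qed

text \<open>Realness on the circle identifies \<open>p\<close> with its reflected conjugate
  polynomial up to powers of \<open>z\<close>. The identity holds at infinitely many points, hence
  everywhere, and the reflected polynomial vanishes at \<open>1 / cnj a\<close>.\<close>

lemma reflected_root:
  fixes p :: "complex poly"
  assumes real: "\<And>z. z \<in> sphere 0 1 \<Longrightarrow> cnj (poly p z * z powi m) = poly p z * z powi m"
    and root: "poly p a = 0" "a \<noteq> 0"
  shows "poly p (1 / cnj a) = 0"
proof -
  define q where "q = reflect_poly (map_poly cnj p)"
  \<comment> \<open>Makes \<open>N + m\<close> and \<open>N - m\<close> both nonnegative, so that
    multiplying by \<open>z powi N\<close> clears the negative exponents.\<close>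
  define N where "N = \<bar>m\<bar>"
  have "p * monom 1 (nat (N + m) + degree p) = q * monom 1 (nat (N - m))"
  proof (rule poly_eqI_unit_circle)
    fix z :: complex
    assume z: "z \<in> sphere 0 1"
    then have z0: "z \<noteq> 0"
      by auto
    have "cnj (z powi m) = z powi (- m)"
      by (simp add: cnj_unit_circle[OF z] power_int_minus power_int_inverse)
    then have "poly p z * z powi m = poly q z / z ^ degree p * z powi (- m)"
      using real[OF z] cnj_poly_unit_circle[OF z, of p] by (simp add: q_def)
    then have "poly p z * z powi m * z ^ degree p = poly q z * z powi (- m)"
      using z0 by (simp add: field_simps)
    then have "poly p z * (z powi N * z powi m) * z ^ degree p = poly q z * (z powi N * z powi (- m))"
      by (simp add: mult_ac)
    also have "z powi N * z powi m = z ^ nat (N + m)"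
      using z0 by (subst power_int_add [symmetric]) (simp_all add: power_int_def N_def)
    also have "z powi N * z powi (- m) = z ^ nat (N - m)"
      using z0 by (subst power_int_add [symmetric]) (simp_all add: power_int_def N_def)
    finally show "poly (p * monom 1 (nat (N + m) + degree p)) z = poly (q * monom 1 (nat (N - m))) z"
      by (simp add: poly_monom power_add mult_ac)
  qed
  then have "poly p (1 / cnj a) * (1 / cnj a) ^ (nat (N + m) + degree p)
      = poly q (1 / cnj a) * (1 / cnj a) ^ nat (N - m)"
    by (metis mult_1 poly_monom poly_mult)
  moreover have "poly q (1 / cnj a) = 0"
    using root by (simp add: q_def poly_reflect_poly_nz)
  ultimately show ?thesis
    using root by simp
qed

text \<open>Induction on the degree. A zero at the origin is absorbed into \<open>m\<close>. Any
  other zero \<open>a\<close> is accompanied by \<open>1 / cnj a\<close>, and on the circle the two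
  linear factors amount, up to a constant, to \<open>z\<close> times the square of
  \<open>norm (z - a)\<close>. So \<open>z - a\<close> goes into \<open>s\<close>, and what remains
  is still positive.\<close>

lemma laurent_fejer_riesz:
  fixes p :: "complex poly"
  assumes "\<And>z. z \<in> sphere 0 1 \<Longrightarrow> \<exists>r>0. poly p z * z powi m = complex_of_real r"
  shows "\<exists>s. \<forall>z\<in>sphere 0 1. poly p z * z powi m = cnj (poly s z) * poly s z"
  using assms
proof (induction "degree p" arbitrary: p m rule: less_induct)
  case less
  have circle: "z \<noteq> 0" if "z \<in> sphere 0 1" for z :: complex
    using that by auto
  have p0: "p \<noteq> 0"
    using less.prems[of 1] by auto
  have nz: "poly p z \<noteq> 0" if "z \<in> sphere 0 1" for z
    using less.prems[OF that] by auto
  show ?case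
  proof (cases "degree p = 0")
    case True
    then obtain c where c: "p = [:c:]"
      by (metis degree_eq_zeroE)
    obtain r where r: "r > 0" "c = complex_of_real r"
      using less.prems[of 1] c by auto
    have "poly p z * z powi m = cnj (poly [:complex_of_real (sqrt r):] z) * poly [:complex_of_real (sqrt r):] z"
      if z: "z \<in> sphere 0 1" for z
    proof -
      \<comment> \<open>A positive number of modulus \<open>r\<close> is \<open>r\<close> itself, so
        the monomial is constant on the circle.\<close>
      obtain u where u: "u > 0" "c * z powi m = complex_of_real u"
        using less.prems[OF z] c by auto
      have "norm (c * z powi m) = r"
        using r z by (simp add: norm_mult norm_power_int)
      then have "u = r"
        using u by simp
      then show ?thesis
        using u r c by (simp add: of_real_mult [symmetric] del: of_real_mult)
    qed
    then show ?thesis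
      by blast
  next
    case False
    then obtain a where a: "poly p a = 0"
      using fundamental_theorem_of_algebra[of p] constant_degree[of p] by auto
    show ?thesis
    proof (cases "a = 0")
      case True
      then obtain q where q: "p = [:0, 1:] * q"
        using a by (metis dvd_def minus_zero poly_eq_0_iff_dvd)
      then have deg: "degree q < degree p"
        using p0 by (auto simp: degree_mult_eq)
      have eq: "poly p z * z powi m = poly q z * z powi (m + 1)" if "z \<in> sphere 0 1" for z
        using circle[OF that] q by (simp add: power_int_add)
      show ?thesis
        using less.hyps[OF deg, of "m + 1"] less.prems eq by simp
    next
      case a0: False
      have "cnj (poly p z * z powi m) = poly p z * z powi m" if "z \<in> sphere 0 1" for z
        using less.prems[OF that] by (metis complex_cnj_complex_of_real)
      then have b: "poly p (1 / cnj a) = 0"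
        using reflected_root a a0 by blast
      obtain p1 where p1: "p = [:-a, 1:] * p1"
        using a by (metis dvd_def poly_eq_0_iff_dvd)
      \<comment> \<open>Positivity excludes zeros on the circle, so \<open>a\<close> differs from
        its reflection and both linear factors split off.\<close>
      have "norm a \<noteq> 1"
        using nz[of a] a by auto
      then have "a * cnj a \<noteq> 1"
        unfolding complex_norm_square [symmetric] of_real_eq_1_iff
        by (simp add: abs_square_eq_1 power2_eq_1_iff)
      then have "1 / cnj a \<noteq> a"
        using a0 by (auto simp: field_simps)
      moreover have "(1 / cnj a - a) * poly p1 (1 / cnj a) = 0"
        using b by (simp add: p1 algebra_simps)
      ultimately have "poly p1 (1 / cnj a) = 0"
        by simp
      then obtain p2 where p2: "p1 = [:-(1 / cnj a), 1:] * p2"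
        by (metis dvd_def poly_eq_0_iff_dvd)
      \<comment> \<open>Normalized so that the second linear factor becomes
        \<open>1 - cnj a * z\<close>, which on the circle is \<open>cnj (z - a) * z\<close>; hence
        the exponent \<open>m + 1\<close>.\<close>
      define q where "q = smult (- 1 / cnj a) p2"
      have "p2 \<noteq> 0"
        using p0 p1 p2 by auto
      then have "degree p = degree p2 + 2"
        unfolding p1 p2 by (simp add: degree_mult_eq del: mult_pCons_left)
      then have deg: "degree q < degree p"
        by (simp add: q_def)
      have eq: "poly p z * z powi m = cnj (z - a) * (z - a) * (poly q z * z powi (m + 1))"
        if z: "z \<in> sphere 0 1" for z
      proof -
        have "poly p z = (z - a) * (1 - cnj a * z) * poly q z"
          using a0 by (simp add: p1 p2 q_def field_simps)
        moreover have "1 - cnj a * z = cnj (z - a) * z"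
          using circle[OF z] by (simp add: cnj_unit_circle[OF z] field_simps)
        ultimately show ?thesis
          using circle[OF z] by (simp add: power_int_add)
      qed
      have "\<exists>r>0. poly q z * z powi (m + 1) = complex_of_real r" if z: "z \<in> sphere 0 1" for z
      proof -
        obtain r where r: "r > 0" "poly p z * z powi m = complex_of_real r"
          using less.prems[OF z] by blast
        have "z \<noteq> a"
          using a nz[OF z] by auto
        then have n: "norm (z - a) > 0"
          by simp
        have "complex_of_real r = complex_of_real ((norm (z - a))\<^sup>2) * (poly q z * z powi (m + 1))"
          using r eq[OF z] complex_norm_square[of "z - a"] by (simp add: mult_ac)
        then have "poly q z * z powi (m + 1) = complex_of_real (r / (norm (z - a))\<^sup>2)"
          using n by (simp add: field_simps)
        then show ?thesis
          using r n by (metis divide_pos_pos zero_less_power)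
      qed
      then obtain s where "\<forall>z\<in>sphere 0 1. poly q z * z powi (m + 1) = cnj (poly s z) * poly s z"
        using less.hyps[OF deg] by blast
      then have "\<forall>z\<in>sphere 0 1. poly p z * z powi m = cnj (poly ([:-a, 1:] * s) z) * poly ([:-a, 1:] * s) z"
        using eq by (simp add: algebra_simps)
      then show ?thesis
        by blast
    qed
  qed
qed

section \<open>Closure properties of rational functions on the circle, and their Fejer-Riesz
  theorem\<close>

definition circle_rational :: "(complex \<Rightarrow> complex) \<Rightarrow> bool" where
  "circle_rational r \<longleftrightarrow>
     (\<exists>P Q :: complex poly. \<forall>z\<in>sphere 0 1. poly Q z \<noteq> 0 \<and> r z = poly P z / poly Q z)"

lemma rational_on_circle_iff:
  "rational_on_circle f \<longleftrightarrow> (\<forall>i j. circle_rational (\<lambda>z. f z $ i $ j))"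
  by (simp add: rational_on_circle_def circle_rational_def)

lemma circle_rationalI:
  "(\<And>z. z \<in> sphere 0 1 \<Longrightarrow> poly Q z \<noteq> 0 \<and> r z = poly P z / poly Q z) \<Longrightarrow> circle_rational r"
  unfolding circle_rational_def by blast

lemma circle_rational_const: "circle_rational (\<lambda>z. c)"
  by (rule circle_rationalI[of 1 _ "[:c:]"]) simp

lemma circle_rational_cong:
  "(\<And>z. z \<in> sphere 0 1 \<Longrightarrow> r z = s z) \<Longrightarrow> circle_rational r \<Longrightarrow> circle_rational s"
  unfolding circle_rational_def by metis

lemma circle_rational_add:
  assumes "circle_rational r" "circle_rational s"
  shows "circle_rational (\<lambda>z. r z + s z)"
proof -
  obtain P Q P' Q' where "\<forall>z\<in>sphere 0 1. poly Q z \<noteq> 0 \<and> r z = poly P z / poly Q z"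
    "\<forall>z\<in>sphere 0 1. poly Q' z \<noteq> 0 \<and> s z = poly P' z / poly Q' z"
    using assms unfolding circle_rational_def by blast
  then show ?thesis
    by (intro circle_rationalI[of "Q * Q'" _ "P * Q' + P' * Q"]) (simp add: field_simps)
qed

lemma circle_rational_mult:
  assumes "circle_rational r" "circle_rational s"
  shows "circle_rational (\<lambda>z. r z * s z)"
proof -
  obtain P Q P' Q' where "\<forall>z\<in>sphere 0 1. poly Q z \<noteq> 0 \<and> r z = poly P z / poly Q z"
    "\<forall>z\<in>sphere 0 1. poly Q' z \<noteq> 0 \<and> s z = poly P' z / poly Q' z"
    using assms unfolding circle_rational_def by blast
  then show ?thesis
    by (intro circle_rationalI[of "Q * Q'" _ "P * P'"]) simp
qed

lemma circle_rational_diff: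
  assumes "circle_rational r" "circle_rational s"
  shows "circle_rational (\<lambda>z. r z - s z)"
  using circle_rational_add[OF assms(1) circle_rational_mult[OF circle_rational_const[of "-1"] assms(2)]]
  by simp

lemma circle_rational_inverse:
  assumes "circle_rational r" "\<And>z. z \<in> sphere 0 1 \<Longrightarrow> r z \<noteq> 0"
  shows "circle_rational (\<lambda>z. inverse (r z))"
proof -
  obtain P Q where PQ: "\<forall>z\<in>sphere 0 1. poly Q z \<noteq> 0 \<and> r z = poly P z / poly Q z"
    using assms unfolding circle_rational_def by blast
  with assms(2) show ?thesis
    by (intro circle_rationalI[of P _ Q]) fastforce
qed

lemma circle_rational_cnj:
  assumes "circle_rational r"
  shows "circle_rational (\<lambda>z. cnj (r z))"
proof -
  obtain P Q where PQ: "\<forall>z\<in>sphere 0 1. poly Q z \<noteq> 0 \<and> r z = poly P z / poly Q z"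
    using assms unfolding circle_rational_def by blast
  have reflect: "circle_rational (\<lambda>z. cnj (poly R z))" for R
    by (rule circle_rationalI[of "monom 1 (degree R)" _ "reflect_poly (map_poly cnj R)"])
      (auto simp: poly_monom cnj_poly_unit_circle)
  have "circle_rational (\<lambda>z. cnj (poly P z) * inverse (cnj (poly Q z)))"
    using PQ by (intro circle_rational_mult circle_rational_inverse reflect) auto
  then show ?thesis
    by (rule circle_rational_cong[rotated]) (use PQ in \<open>auto simp: divide_inverse\<close>)
qed

text \<open>Multiplying \<open>r\<close> by the square of \<open>norm (poly Q z)\<close> gives a
  positive Laurent polynomial on the circle. Its Fejer-Riesz factor is then divided by
  \<open>Q\<close>.\<close>

lemma circle_rational_fejer_riesz:
  assumes "circle_rational r" and pos: "\<And>z. z \<in> sphere 0 1 \<Longrightarrow> \<exists>x>0. r z = complex_of_real x"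
  shows "\<exists>s. circle_rational s \<and> (\<forall>z\<in>sphere 0 1. r z = cnj (s z) * s z)"
proof -
  obtain P Q where PQ: "\<And>z. z \<in> sphere 0 1 \<Longrightarrow> poly Q z \<noteq> 0 \<and> r z = poly P z / poly Q z"
    using assms unfolding circle_rational_def by blast
  define N where "N = P * reflect_poly (map_poly cnj Q)"
  have N: "poly N z * z powi (- int (degree Q)) = r z * (cnj (poly Q z) * poly Q z)"
    if "z \<in> sphere 0 1" for z
    using PQ[OF that] by (simp add: N_def cnj_poly_unit_circle[OF that] power_int_minus field_simps)
  have "\<exists>x>0. poly N z * z powi (- int (degree Q)) = complex_of_real x" if z: "z \<in> sphere 0 1" for z
  proof -
    obtain x where x: "x > 0" "r z = complex_of_real x"
      using pos[OF z] by blast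
    have "poly N z * z powi (- int (degree Q)) = complex_of_real (x * (norm (poly Q z))\<^sup>2)"
      using complex_norm_square[of "poly Q z"] by (simp add: N[OF z] x mult_ac)
    moreover have "x * (norm (poly Q z))\<^sup>2 > 0"
      using x PQ[OF z] by simp
    ultimately show ?thesis
      by blast
  qed
  then obtain s where s: "\<forall>z\<in>sphere 0 1. poly N z * z powi (- int (degree Q)) = cnj (poly s z) * poly s z"
    using laurent_fejer_riesz by blast
  have "circle_rational (\<lambda>z. poly s z / poly Q z)"
    using PQ by (intro circle_rationalI[of Q]) auto
  moreover have "r z = cnj (poly s z / poly Q z) * (poly s z / poly Q z)" if z: "z \<in> sphere 0 1" for z
    using N[OF z] s z PQ[OF z] by (simp add: field_simps)
  ultimately show ?thesis
    by blast
qed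

section \<open>Symmetric elimination\<close>

text \<open>Each step eliminates one index \<open>k\<close>: a rank-one Gram term accounts for row
  and column \<open>k\<close>, and the Schur complement \<open>F'\<close> is again Hermitian and
  positive on \<open>S\<close>. Only the pivots need square roots, so everything stays rational.
  Index functions over a finite set let the size shrink.\<close>

lemma rational_cholesky:
  fixes F :: "complex \<Rightarrow> 'n \<Rightarrow> 'n \<Rightarrow> complex"
  assumes "finite S"
    and "\<And>i j. circle_rational (\<lambda>z. F z i j)"
    and "\<And>z i j. z \<in> sphere 0 1 \<Longrightarrow> cnj (F z i j) = F z j i"
    and "\<And>z x. \<lbrakk>z \<in> sphere 0 1; \<exists>i\<in>S. x i \<noteq> 0\<rbrakk>
           \<Longrightarrow> 0 < Re (\<Sum>i\<in>S. \<Sum>j\<in>S. cnj (x i) * F z i j * x j)"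
  shows "\<exists>G. (\<forall>i j. circle_rational (\<lambda>z. G z i j)) \<and>
           (\<forall>z\<in>sphere 0 1. \<forall>i\<in>S. \<forall>j\<in>S. F z i j = (\<Sum>k\<in>S. cnj (G z k i) * G z k j))"
  using assms
proof (induction S arbitrary: F rule: finite_induct)
  case empty
  show ?case
    by (intro exI[of _ "\<lambda>z i j. 0"]) (simp add: circle_rational_const)
next
  case (insert k S)
  note rat = insert.prems(1) and herm = insert.prems(2) and pos = insert.prems(3)
  have kk: "\<exists>r>0. F z k k = complex_of_real r" if z: "z \<in> sphere 0 1" for z
  proof -
    define x :: "'n \<Rightarrow> complex" where "x i = of_bool (i = k)" for i
    have x: "x k = 1" "\<And>i. i \<in> S \<Longrightarrow> x i = 0"
      using insert.hyps by (auto simp: x_def)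
    have "0 < Re (\<Sum>i\<in>insert k S. \<Sum>j\<in>insert k S. cnj (x i) * F z i j * x j)"
      by (rule pos[OF z]) (simp add: x)
    also have "(\<Sum>i\<in>insert k S. \<Sum>j\<in>insert k S. cnj (x i) * F z i j * x j) = F z k k"
      using insert.hyps by (simp add: x cong: sum.cong)
    finally have "0 < Re (F z k k)" .
    moreover have "F z k k = complex_of_real (Re (F z k k))"
      using herm[OF z, of k k] by (simp add: complex_eq_iff)
    ultimately show ?thesis
      by blast
  qed
  then obtain s where s: "circle_rational s" "\<And>z. z \<in> sphere 0 1 \<Longrightarrow> F z k k = cnj (s z) * s z"
    using circle_rational_fejer_riesz[OF rat[of k k]] by blast
  have nz: "F z k k \<noteq> 0" if "z \<in> sphere 0 1" for z
    using kk[OF that] by auto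
  \<comment> \<open>The row of \<open>G\<close> for the pivot: because
    \<open>cnj (s z) * s z = F z k k\<close>, the products \<open>cnj (u z i) * u z j\<close>
    reproduce \<open>F\<close> whenever \<open>i = k\<close> or \<open>j = k\<close>.\<close>
  define u where "u z j = s z * F z k j * inverse (F z k k)" for z j
  define F' where "F' z i j = F z i j - cnj (u z i) * u z j" for z i j
  have u_rat: "circle_rational (\<lambda>z. u z j)" for j
    unfolding u_def by (intro circle_rational_mult circle_rational_inverse s rat nz)
  have uu: "cnj (u z i) * u z j = F z i k * F z k j / F z k k" if z: "z \<in> sphere 0 1" for z i j
    using nz[OF z] by (simp add: u_def herm[OF z] s(2)[OF z] divide_simps)
  have "\<exists>G. (\<forall>i j. circle_rational (\<lambda>z. G z i j)) \<and>
           (\<forall>z\<in>sphere 0 1. \<forall>i\<in>S. \<forall>j\<in>S. F' z i j = (\<Sum>k\<in>S. cnj (G z k i) * G z k j))"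
  proof (rule insert.IH)
    show "circle_rational (\<lambda>z. F' z i j)" for i j
      unfolding F'_def by (intro circle_rational_diff circle_rational_mult circle_rational_cnj u_rat rat)
    show "cnj (F' z i j) = F' z j i" if "z \<in> sphere 0 1" for z i j
      using herm[OF that] by (simp add: F'_def)
    show "0 < Re (\<Sum>i\<in>S. \<Sum>j\<in>S. cnj (x i) * F' z i j * x j)"
      if z: "z \<in> sphere 0 1" and x: "\<exists>i\<in>S. x i \<noteq> 0" for z x
    proof -
      define T where "T = (\<Sum>j\<in>S. F z k j * x j)"
      define Q where "Q = (\<Sum>i\<in>S. \<Sum>j\<in>S. cnj (x i) * F z i j * x j)"
      \<comment> \<open>This coordinate \<open>k\<close> minimizes the form of \<open>F\<close> over
        all extensions of \<open>x\<close>; by completing the square the minimum is the form of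
        \<open>F'\<close> at \<open>x\<close>.\<close>
      define y where "y = x(k := - T / F z k k)"
      have yS: "y i = x i" if "i \<in> S" for i
        using insert.hyps that by (auto simp: y_def)
      have cT: "cnj T = (\<Sum>i\<in>S. cnj (x i) * F z i k)"
        by (simp add: T_def herm[OF z] mult.commute)
      have "0 < Re (\<Sum>i\<in>insert k S. \<Sum>j\<in>insert k S. cnj (y i) * F z i j * y j)"
        using x yS by (intro pos[OF z]) auto
      also have "(\<Sum>i\<in>insert k S. \<Sum>j\<in>insert k S. cnj (y i) * F z i j * y j)
          = cnj (y k) * F z k k * y k + (\<Sum>j\<in>S. cnj (y k) * F z k j * x j)
            + ((\<Sum>i\<in>S. cnj (x i) * F z i k * y k) + Q)"
        using insert.hyps yS by (simp add: Q_def sum.distrib cong: sum.cong)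
      also have "(\<Sum>j\<in>S. cnj (y k) * F z k j * x j) = cnj (y k) * T"
        by (simp add: T_def sum_distrib_left mult_ac)
      also have "(\<Sum>i\<in>S. cnj (x i) * F z i k * y k) = cnj T * y k"
        by (simp add: cT sum_distrib_right)
      also have "cnj (y k) * F z k k * y k + cnj (y k) * T + (cnj T * y k + Q) = Q - cnj T * T / F z k k"
        using nz[OF z] herm[OF z, of k k] by (simp add: y_def field_simps)
      also have "Q - cnj T * T / F z k k = (\<Sum>i\<in>S. \<Sum>j\<in>S. cnj (x i) * F' z i j * x j)"
      proof -
        have TT: "cnj T * T / F z k k = (\<Sum>i\<in>S. \<Sum>j\<in>S. (cnj (x i) * F z i k) * (F z k j * x j) / F z k k)"
          unfolding cT unfolding T_def sum_product sum_divide_distrib ..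
        have F': "F' z i j = F z i j - F z i k * F z k j / F z k k" for i j
          by (simp only: F'_def uu[OF z])
        show ?thesis
          unfolding TT by (simp add: Q_def F' sum_subtractf [symmetric] algebra_simps)
      qed
      finally show ?thesis .
    qed
  qed
  then obtain G' where G': "\<And>i j. circle_rational (\<lambda>z. G' z i j)"
    "\<And>z i j. \<lbrakk>z \<in> sphere 0 1; i \<in> S; j \<in> S\<rbrakk> \<Longrightarrow> F' z i j = (\<Sum>k\<in>S. cnj (G' z k i) * G' z k j)"
    by blast
  \<comment> \<open>The zeros in column \<open>k\<close> keep the factor of \<open>F'\<close> away
    from row and column \<open>k\<close>, which \<open>u\<close> already accounts for.\<close>
  define G where "G z l j = (if l = k then u z j else if j = k then 0 else G' z l j)" for z l j
  have "circle_rational (\<lambda>z. G z l j)" for l j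
    unfolding G_def using u_rat G'(1) circle_rational_const by (cases "l = k"; cases "j = k") auto
  moreover have "F z i j = (\<Sum>l\<in>insert k S. cnj (G z l i) * G z l j)"
    if z: "z \<in> sphere 0 1" and i: "i \<in> insert k S" and j: "j \<in> insert k S" for z i j
  proof -
    have "(\<Sum>l\<in>insert k S. cnj (G z l i) * G z l j)
        = cnj (u z i) * u z j + (\<Sum>l\<in>S. if i = k \<or> j = k then 0 else cnj (G' z l i) * G' z l j)"
      using insert.hyps by (auto simp: G_def intro!: sum.cong)
    also have "\<dots> = F z i j"
    proof (cases "i = k \<or> j = k")
      case True
      then show ?thesis
        using nz[OF z] by (auto simp: uu[OF z])
    next
      case False
      then have "i \<in> S" "j \<in> S"
        using i j by auto
      then have "F z i j = cnj (u z i) * u z j + (\<Sum>l\<in>S. cnj (G' z l i) * G' z l j)"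
        using G'(2)[OF z, of i j] by (simp only: F'_def diff_eq_eq add.commute)
      then show ?thesis
        using False by simp
    qed
    finally show ?thesis ..
  qed
  ultimately show ?case
    by blast
qed

section \<open>Rational square roots of positive matrix functions\<close>

lemma mat_adjoint_nth [simp]: "mat_adjoint A $ i $ j = cnj (A $ j $ i)"
  by (simp add: mat_adjoint_def)

lemma mat_adjoint_mult: "mat_adjoint (A ** B) = mat_adjoint B ** mat_adjoint A"
  by (simp add: vec_eq_iff matrix_matrix_mult_def mult.commute)

lemma mat_adjoint_mat_1 [simp]: "mat_adjoint (mat 1) = mat 1"
  by (simp add: vec_eq_iff mat_def)

lemma pos_def_cnj_nth: "pos_def A \<Longrightarrow> cnj (A $ i $ j) = A $ j $ i"
  by (metis pos_def_def mat_adjoint_nth)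

definition poly_matrix :: "'a::comm_ring_1 poly ^ 'n ^ 'm \<Rightarrow> 'a \<Rightarrow> 'a ^ 'n ^ 'm" where
  "poly_matrix M z = (\<chi> i j. poly (M $ i $ j) z)"

lemma poly_matrix_nth [simp]: "poly_matrix M z $ i $ j = poly (M $ i $ j) z"
  by (simp add: poly_matrix_def)

lemma poly_det: "poly (det M) z = det (poly_matrix M z)"
  by (simp add: det_def poly_sum poly_prod)

text \<open>A common denominator turns the Cholesky factor into a polynomial matrix \<open>M\<close>
  over a scalar \<open>q\<close>, so that the zeros of \<open>det M\<close> and of \<open>q\<close>
  can be removed separately. A null vector of \<open>poly_matrix M z\<close> would be one of
  \<open>F z\<close>, which positivity forbids.\<close>

lemma rational_square_root:
  fixes F :: "complex \<Rightarrow> complex ^ 'n ^ 'n"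
  assumes "rational_on_circle F" and "\<And>z. z \<in> sphere 0 1 \<Longrightarrow> pos_def (F z)"
  shows "\<exists>M q. \<forall>z\<in>sphere 0 1. poly q z \<noteq> 0 \<and> poly (det M) z \<noteq> 0 \<and>
    (\<forall>i j. F z $ i $ j = (mat_adjoint (poly_matrix M z) ** poly_matrix M z) $ i $ j / (cnj (poly q z) * poly q z))"
proof -
  have "\<exists>G :: complex \<Rightarrow> 'n \<Rightarrow> 'n \<Rightarrow> complex. (\<forall>i j. circle_rational (\<lambda>z. G z i j)) \<and>
      (\<forall>z\<in>sphere 0 1. \<forall>i\<in>UNIV. \<forall>j\<in>UNIV. F z $ i $ j = (\<Sum>k\<in>UNIV. cnj (G z k i) * G z k j))"
  proof (rule rational_cholesky[where F = "\<lambda>z i j. F z $ i $ j"])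
    show "circle_rational (\<lambda>z. F z $ i $ j)" for i j
      using assms(1) rational_on_circle_iff by blast
    show "cnj (F z $ i $ j) = F z $ j $ i" if "z \<in> sphere 0 1" for z i j
      using pos_def_cnj_nth assms(2)[OF that] by blast
    show "0 < Re (\<Sum>i\<in>UNIV. \<Sum>j\<in>UNIV. cnj (x i) * F z $ i $ j * x j)"
      if z: "z \<in> sphere 0 1" and x: "\<exists>i\<in>UNIV. x i \<noteq> 0" for z x
    proof -
      have "vec_lambda x \<noteq> 0"
        using x by (auto simp: vec_eq_iff)
      then show ?thesis
        using assms(2)[OF z] unfolding pos_def_def
        by (auto simp: matrix_vector_mult_def sum_distrib_left mult.assoc)
    qed
  qed simp
  then obtain G :: "complex \<Rightarrow> 'n \<Rightarrow> 'n \<Rightarrow> complex" where G: "\<And>i j. circle_rational (\<lambda>z. G z i j)"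
    "\<And>z i j. z \<in> sphere 0 1 \<Longrightarrow> F z $ i $ j = (\<Sum>k\<in>UNIV. cnj (G z k i) * G z k j)"
    unfolding ball_UNIV by blast
  have "\<forall>i j. \<exists>P Q. \<forall>z\<in>sphere 0 1. poly Q z \<noteq> 0 \<and> G z i j = poly P z / poly Q z"
    using G(1) unfolding circle_rational_def by blast
  then obtain P Q where PQ: "\<And>i j z. z \<in> sphere 0 1 \<Longrightarrow> poly (Q i j) z \<noteq> 0 \<and> G z i j = poly (P i j) z / poly (Q i j) z"
    by metis
  define q where "q = (\<Prod>(i, j)\<in>UNIV. Q i j)"
  define M :: "complex poly ^ 'n ^ 'n" where
    "M = (\<chi> i j. P i j * (\<Prod>(k, l)\<in>UNIV - {(i, j)}. Q k l))"
  have q: "poly q z \<noteq> 0" if "z \<in> sphere 0 1" for z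
    using PQ[OF that] by (simp add: q_def poly_prod split_beta)
  have GM: "G z i j = poly (M $ i $ j) z / poly q z" if z: "z \<in> sphere 0 1" for z i j
  proof -
    have "q = Q i j * (\<Prod>(k, l)\<in>UNIV - {(i, j)}. Q k l)"
      unfolding q_def by (subst prod.remove[of _ "(i, j)"]) auto
    then have "poly q z = poly (Q i j) z * poly (\<Prod>(k, l)\<in>UNIV - {(i, j)}. Q k l) z"
      by simp
    then show ?thesis
      using PQ[OF z] q[OF z] by (simp add: M_def)
  qed
  have FM: "F z $ i $ j = (mat_adjoint (poly_matrix M z) ** poly_matrix M z) $ i $ j / (cnj (poly q z) * poly q z)"
    if z: "z \<in> sphere 0 1" for z i j
    by (simp add: G(2)[OF z] GM[OF z] matrix_matrix_mult_def sum_divide_distrib)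
  have "poly (det M) z \<noteq> 0" if z: "z \<in> sphere 0 1" for z
  proof
    assume "poly (det M) z = 0"
    then have "\<not> (\<exists>B. B ** poly_matrix M z = mat 1)"
      using invertible_det_nz invertible_left_inverse by (metis poly_det)
    then obtain x where x: "poly_matrix M z *v x = 0" "x \<noteq> 0"
      using matrix_left_invertible_ker by blast
    have "mat_adjoint (poly_matrix M z) ** poly_matrix M z = (\<chi> i j. (cnj (poly q z) * poly q z) * F z $ i $ j)"
      using FM[OF z] q[OF z] by (simp add: vec_eq_iff)
    moreover have "(mat_adjoint (poly_matrix M z) ** poly_matrix M z) *v x = 0"
      using x by (simp add: matrix_vector_mul_assoc [symmetric])
    ultimately have "(cnj (poly q z) * poly q z) * (F z *v x) $ i = 0" for i
      by (simp add: matrix_vector_mult_def sum_distrib_left mult.assoc vec_eq_iff)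
    then have "(F z *v x) $ i = 0" for i
      using q[OF z] by simp
    then show False
      using assms(2)[OF z] x(2) unfolding pos_def_def by auto
  qed
  then show ?thesis
    using FM q by blast
qed

section \<open>Removing zeros from the disc\<close>

text \<open>Pythagoras: adding multiples of the adjoint of \<open>v\<close> to the columns affects
  only their components along that vector. Their products with \<open>v\<close> change from
  \<open>s\<close> to \<open>s + c\<close> and from \<open>t\<close> to
  \<open>t + d\<close>.\<close>

lemma gram_rank_one_update:
  fixes m :: "'n::finite \<Rightarrow> 'n \<Rightarrow> complex"
  assumes "(\<Sum>k\<in>UNIV. v k * cnj (v k)) = w" "w \<noteq> 0"
    and "(\<Sum>k\<in>UNIV. v k * m k i) = s" "(\<Sum>k\<in>UNIV. v k * m k j) = t"
  shows "(\<Sum>k\<in>UNIV. cnj (m k i + cnj (v k) / w * c) * (m k j + cnj (v k) / w * d))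
    = (\<Sum>k\<in>UNIV. cnj (m k i) * m k j) + (cnj (s + c) * (t + d) - cnj s * t) / w"
proof -
  have w: "cnj w = w"
    unfolding assms(1) [symmetric] by (simp add: mult.commute)
  have s: "cnj s = (\<Sum>k\<in>UNIV. cnj (v k) * cnj (m k i))"
    by (simp add: assms(3) [symmetric])
  have "(\<Sum>k\<in>UNIV. cnj (m k i + cnj (v k) / w * c) * (m k j + cnj (v k) / w * d))
    = (\<Sum>k\<in>UNIV. cnj (m k i) * m k j + d / w * (cnj (v k) * cnj (m k i))
        + cnj c / w * (v k * m k j) + cnj c * d / w\<^sup>2 * (v k * cnj (v k)))"
    by (intro sum.cong refl) (simp add: w algebra_simps power2_eq_square)
  also have "\<dots> = (\<Sum>k\<in>UNIV. cnj (m k i) * m k j) + d / w * cnj s + cnj c / w * t + cnj c * d / w\<^sup>2 * w"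
    by (simp only: sum.distrib sum_distrib_left [symmetric] assms s)
  finally show ?thesis
    using assms(2) by (simp add: field_simps power2_eq_square)
qed

text \<open>Let \<open>v M(a) = 0\<close>, let \<open>P\<close> be the orthogonal projection onto the line of \<open>v\<^sup>*\<close>, and let
  \<open>\<beta>(z) = (1 - cnj a z) / (z - a)\<close>, which is unimodular on the circle. Then \<open>M' = (I - P + \<beta> P) M\<close>
  is again a polynomial matrix, and \<open>R = (1 - cnj a z) (I - P + \<beta> P)\<^sup>-\<^sup>1\<close> is one as well.\<close>

lemma blaschke_factor_removal:
  fixes M :: "complex poly ^ 'n ^ 'n"
  assumes "poly (det M) a = 0"
  shows "\<exists>M' R. mat [:1, - cnj a:] ** M = R ** M' \<and> poly (det R) a = 0 \<and>
    (\<forall>z\<in>sphere 0 1. mat_adjoint (poly_matrix M' z) ** poly_matrix M' z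
        = mat_adjoint (poly_matrix M z) ** poly_matrix M z)"
proof -
  have "det (transpose (poly_matrix M a)) = 0"
    using assms by (simp add: poly_det det_transpose)
  then have "\<not> (\<exists>B. B ** transpose (poly_matrix M a) = mat 1)"
    using invertible_det_nz invertible_left_inverse by metis
  then obtain u where u: "transpose (poly_matrix M a) *v u = 0" "u \<noteq> 0"
    using matrix_left_invertible_ker by blast
  define v where "v k = u $ k" for k
  have v: "(\<Sum>k\<in>UNIV. v k * poly (M $ k $ j) a) = 0" for j
    using u(1) by (simp add: vec_eq_iff matrix_vector_mult_def transpose_def v_def mult.commute)
  obtain i0 where i0: "v i0 \<noteq> 0"
    using u(2) by (auto simp: vec_eq_iff v_def)
  define w where "w = (\<Sum>k\<in>UNIV. v k * cnj (v k))"
  have "w = complex_of_real (\<Sum>k\<in>UNIV. (norm (v k))\<^sup>2)"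
    by (simp add: w_def complex_norm_square del: of_real_power)
  moreover have "(\<Sum>k\<in>UNIV. (norm (v k))\<^sup>2) > 0"
    using i0 by (intro sum_pos2[of _ i0]) auto
  ultimately have w: "w \<noteq> 0"
    by (metis less_irrefl of_real_eq_0_iff)
  \<comment> \<open>Each entry of \<open>v M\<close> vanishes at \<open>a\<close>. This divisibility
    cancels the pole of \<beta>.\<close>
  have "\<exists>y. (\<Sum>k\<in>UNIV. [:v k:] * M $ k $ j) = [:-a, 1:] * y" for j
  proof -
    have "poly (\<Sum>k\<in>UNIV. [:v k:] * M $ k $ j) a = 0"
      using v[of j] by (simp add: poly_sum)
    then show ?thesis
      unfolding poly_eq_0_iff_dvd dvd_def .
  qed
  then obtain y where y: "\<And>j. (\<Sum>k\<in>UNIV. [:v k:] * M $ k $ j) = [:-a, 1:] * y j"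
    by metis
  have vM: "(\<Sum>k\<in>UNIV. v k * poly (M $ k $ j) z) = (z - a) * poly (y j) z" for j z
    using arg_cong[OF y, of "\<lambda>p. poly p z" j] by (simp add: poly_sum algebra_simps)
  \<comment> \<open>This is \<open>M + (\<beta> - 1) P M\<close>: the entries of \<open>P M\<close>
    are \<open>cnj (v i) / w\<close> times \<open>(z - a) y\<close>, and
    \<open>(\<beta> - 1) (z - a)\<close> is \<open>(1 - cnj a z) - (z - a)\<close>.\<close>
  define M' :: "complex poly ^ 'n ^ 'n" where
    "M' = (\<chi> i j. M $ i $ j + [:cnj (v i) / w:] * ([:1 + a, - 1 - cnj a:] * y j))"
  define R :: "complex poly ^ 'n ^ 'n" where
    "R = (\<chi> i j. (if i = j then [:1, - cnj a:] else 0) + [:cnj (v i) / w * v j:] * [:- 1 - a, 1 + cnj a:])"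
  have M': "poly (M' $ i $ j) z
      = poly (M $ i $ j) z + cnj (v i) / w * (((1 - cnj a * z) - (z - a)) * poly (y j) z)" for i j z
    by (simp add: M'_def add_divide_distrib diff_divide_distrib algebra_simps)
  have R: "poly (R $ i $ j) z
      = (if i = j then 1 - cnj a * z else 0) + cnj (v i) / w * v j * ((z - a) - (1 - cnj a * z))" for i j z
    by (simp add: R_def add_divide_distrib diff_divide_distrib algebra_simps)
  \<comment> \<open>Along \<open>v\<close> the factor \<open>z - a\<close> is exchanged for
    \<open>1 - cnj a * z\<close>.\<close>
  have vM': "(\<Sum>k\<in>UNIV. v k * poly (M' $ k $ j) z) = (1 - cnj a * z) * poly (y j) z" for j z
  proof -
    let ?c = "((1 - cnj a * z) - (z - a)) * poly (y j) z"
    have "(\<Sum>k\<in>UNIV. v k * poly (M' $ k $ j) z)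
        = (\<Sum>k\<in>UNIV. v k * poly (M $ k $ j) z + ?c / w * (v k * cnj (v k)))"
      unfolding M' by (intro sum.cong refl) (simp add: add_divide_distrib diff_divide_distrib algebra_simps)
    also have "\<dots> = (z - a) * poly (y j) z + ?c / w * w"
      by (simp only: sum.distrib sum_distrib_left [symmetric] vM w_def)
    finally show ?thesis
      using w by (simp add: add_divide_distrib diff_divide_distrib algebra_simps)
  qed
  have "mat [:1, - cnj a:] ** M = R ** M'"
  proof -
    have "poly ((mat [:1, - cnj a:] ** M) $ i $ j) z = poly ((R ** M') $ i $ j) z" for i j z
    proof -
      let ?e = "1 - cnj a * z"
      have "poly ((R ** M') $ i $ j) z = (\<Sum>k\<in>UNIV. poly (R $ i $ k) z * poly (M' $ k $ j) z)"
        by (simp add: matrix_matrix_mult_def poly_sum)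
      also have "\<dots> = (\<Sum>k\<in>UNIV. (if k = i then ?e * poly (M' $ k $ j) z else 0)
          + cnj (v i) / w * ((z - a) - ?e) * (v k * poly (M' $ k $ j) z))"
        unfolding R by (intro sum.cong refl) (auto simp: add_divide_distrib diff_divide_distrib algebra_simps)
      also have "\<dots> = ?e * poly (M' $ i $ j) z + cnj (v i) / w * ((z - a) - ?e) * (?e * poly (y j) z)"
        by (simp only: sum.distrib sum_distrib_left [symmetric] vM') simp
      also have "\<dots> = ?e * poly (M $ i $ j) z"
        unfolding M' by (simp add: add_divide_distrib diff_divide_distrib algebra_simps)
      also have "\<dots> = poly ((mat [:1, - cnj a:] ** M) $ i $ j) z"
        by (simp add: matrix_matrix_mult_def mat_def poly_sum if_distrib if_distribR algebra_simps cong: if_cong)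
      finally show ?thesis ..
    qed
    then show ?thesis
      unfolding vec_eq_iff by (metis poly_eq_poly_eq_iff ext)
  qed
  \<comment> \<open>At \<open>a\<close> the matrix \<open>R\<close> equals
    \<open>(1 - cnj a a) (I - P)\<close>, which annihilates the adjoint of \<open>v\<close>. So
    \<open>det R\<close> takes up the zero that leaves \<open>det M\<close>.\<close>
  moreover have "poly (det R) a = 0"
  proof -
    define x :: "complex ^ 'n" where "x = (\<chi> i. cnj (v i))"
    have "(\<Sum>k\<in>UNIV. poly (R $ i $ k) a * cnj (v k)) = 0" for i
    proof -
      have "(\<Sum>k\<in>UNIV. poly (R $ i $ k) a * cnj (v k))
        = (\<Sum>k\<in>UNIV. (if k = i then (1 - cnj a * a) * cnj (v k) else 0)
          - cnj (v i) / w * (1 - cnj a * a) * (v k * cnj (v k)))"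
        unfolding R by (intro sum.cong refl) (auto simp: add_divide_distrib diff_divide_distrib algebra_simps)
      also have "\<dots> = (1 - cnj a * a) * cnj (v i) - cnj (v i) / w * (1 - cnj a * a) * w"
        by (simp only: sum_subtractf sum_distrib_left [symmetric] w_def) simp
      finally show ?thesis
        using w by simp
    qed
    then have "poly_matrix R a *v x = 0"
      by (simp add: vec_eq_iff matrix_vector_mult_def x_def)
    moreover have "x \<noteq> 0"
      using i0 by (auto simp: vec_eq_iff x_def)
    ultimately show ?thesis
      using invertible_det_nz invertible_left_inverse matrix_left_invertible_ker by (metis poly_det)
  qed
  moreover have "mat_adjoint (poly_matrix M' z) ** poly_matrix M' z
      = mat_adjoint (poly_matrix M z) ** poly_matrix M z" if z: "z \<in> sphere 0 1" for z
  proof -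
    have "(\<Sum>k\<in>UNIV. cnj (poly (M' $ k $ i) z) * poly (M' $ k $ j) z)
        = (\<Sum>k\<in>UNIV. cnj (poly (M $ k $ i) z) * poly (M $ k $ j) z)" for i j
    proof -
      \<comment> \<open>The two sums collapse to \<open>(1 - cnj a * z) * p\<close> and
        \<open>(1 - cnj a * z) * q\<close>, so the correction to the Gram matrix vanishes by
        unimodularity.\<close>
      have eq: "cnj ((z - a) * p + ((1 - cnj a * z) - (z - a)) * p) * ((z - a) * q + ((1 - cnj a * z) - (z - a)) * q)
          - cnj ((z - a) * p) * ((z - a) * q) = 0" for p q
      proof -
        have "cnj ((z - a) * p + ((1 - cnj a * z) - (z - a)) * p) * ((z - a) * q + ((1 - cnj a * z) - (z - a)) * q)
          - cnj ((z - a) * p) * ((z - a) * q)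
          = ((1 - cnj a * z) * cnj (1 - cnj a * z) - (z - a) * cnj (z - a)) * (cnj p * q)"
          by (simp add: algebra_simps)
        then show ?thesis
          by (simp only: norm_unit_circle_reflect[OF z]) simp
      qed
      show ?thesis
        unfolding M' gram_rank_one_update[where m = "\<lambda>k i. poly (M $ k $ i) z", OF w_def [symmetric] w vM vM] eq
        by simp
    qed
    then show ?thesis
      by (simp add: vec_eq_iff matrix_matrix_mult_def)
  qed
  ultimately show ?thesis
    by blast
qed

text \<open>Induction on the number of zeros of \<open>det M\<close> in the open disc, with
  multiplicity. Taking determinants in the Blaschke identity, the scalar factor has no zero in the
  closed disc while \<open>det R\<close> vanishes at \<open>a\<close>, so \<open>det M'\<close> has
  fewer zeros there than \<open>det M\<close>.\<close>

lemma zero_free_in_disc: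
  fixes M :: "complex poly ^ 'n ^ 'n"
  assumes "\<And>z. z \<in> sphere 0 1 \<Longrightarrow> poly (det M) z \<noteq> 0"
  shows "\<exists>M'. (\<forall>z\<in>cball 0 1. poly (det M') z \<noteq> 0) \<and>
    (\<forall>z\<in>sphere 0 1. mat_adjoint (poly_matrix M' z) ** poly_matrix M' z
        = mat_adjoint (poly_matrix M z) ** poly_matrix M z)"
  using assms
proof (induction "size {#z \<in># proots (det M). norm z < 1#}" arbitrary: M rule: less_induct)
  case less
  show ?case
  proof (cases "\<forall>z\<in>cball 0 1. poly (det M) z \<noteq> 0")
    case True
    then show ?thesis
      by blast
  next
    case False
    then obtain a where a: "norm a \<le> 1" "poly (det M) a = 0"
      by auto
    then have a1: "norm a < 1"
      using less.prems[of a] by force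
    obtain M' R where R: "mat [:1, - cnj a:] ** M = R ** M'" "poly (det R) a = 0"
      and gram: "\<forall>z\<in>sphere 0 1. mat_adjoint (poly_matrix M' z) ** poly_matrix M' z
        = mat_adjoint (poly_matrix M z) ** poly_matrix M z"
      using blaschke_factor_removal[OF a(2)] by blast
    have "det (mat [:1, - cnj a:] :: complex poly ^ 'n ^ 'n) = [:1, - cnj a:] ^ CARD('n)"
      by (subst det_diagonal) (auto simp: mat_def)
    then have det: "[:1, - cnj a:] ^ CARD('n) * det M = det R * det M'"
      using arg_cong[OF R(1), of det] by (simp add: det_mul)
    have e: "poly [:1, - cnj a:] z \<noteq> 0" if "norm z \<le> 1" for z
    proof
      assume "poly [:1, - cnj a:] z = 0"
      then have "norm (z * cnj a) = 1"
        by (metis add_uminus_conv_diff eq_iff_diff_eq_0 mult_minus_right norm_one poly_0 poly_pCons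
            add.right_neutral mult_zero_right)
      then show False
        using a1 that mult_left_le_one_le[of "norm a" "norm z"] by (simp add: norm_mult)
    qed
    have M0: "det M \<noteq> 0"
      using less.prems[of 1] by auto
    then have nz: "[:1, - cnj a:] ^ CARD('n) * det M \<noteq> 0" "det R * det M' \<noteq> 0"
      unfolding det [symmetric] by auto
    have M'nz: "poly (det M') z \<noteq> 0" if z: "z \<in> sphere 0 1" for z
    proof
      assume "poly (det M') z = 0"
      then have "poly ([:1, - cnj a:] ^ CARD('n) * det M) z = 0"
        by (simp add: det)
      then show False
        using less.prems[OF z] e[of z] z by (simp add: poly_power)
    qed
    define Z where "Z p = {#z \<in># proots p. norm z < 1#}" for p :: "complex poly"
    have Z_mult: "Z (p * q) = Z p + Z q" if "p * q \<noteq> 0" for p q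
      using that by (simp add: Z_def proots_mult)
    have "set_mset (Z ([:1, - cnj a:] ^ CARD('n))) = {}"
      using e by (auto simp: Z_def poly_power)
    then have "Z (det M) = Z (det R) + Z (det M')"
      using arg_cong[OF det, of Z] nz by (simp only: Z_mult[OF nz(1)] Z_mult[OF nz(2)] set_mset_eq_empty_iff add_0)
    moreover have "Z (det R) \<noteq> {#}"
    proof -
      have "a \<in># Z (det R)"
        using nz R(2) a1 by (auto simp: Z_def)
      then show ?thesis
        by auto
    qed
    ultimately have "size (Z (det M')) < size (Z (det M))"
      by (simp add: nonempty_has_size)
    then have "size {#z \<in># proots (det M'). norm z < 1#} < size {#z \<in># proots (det M). norm z < 1#}"
      unfolding Z_def .
    then obtain M'' where "\<forall>z\<in>cball 0 1. poly (det M'') z \<noteq> 0"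
      "\<forall>z\<in>sphere 0 1. mat_adjoint (poly_matrix M'' z) ** poly_matrix M'' z
        = mat_adjoint (poly_matrix M' z) ** poly_matrix M' z"
      using less.hyps M'nz by blast
    then show ?thesis
      using gram by auto
  qed
qed

section \<open>Membership in the Wiener algebras\<close>

text \<open>The denominator is controlled on the whole closed disc, so that the quotient is analytic
  beyond the circle; values are compared only on the circle, where \<open>wiener_plus\<close> sees
  them.\<close>

definition disc_rational :: "(complex \<Rightarrow> complex) \<Rightarrow> bool" where
  "disc_rational r \<longleftrightarrow>
     (\<exists>P Q :: complex poly. (\<forall>z\<in>cball 0 1. poly Q z \<noteq> 0) \<and> (\<forall>z\<in>sphere 0 1. r z = poly P z / poly Q z))"

lemma disc_rationalI:
  "(\<And>z. z \<in> cball 0 1 \<Longrightarrow> poly Q z \<noteq> 0) \<Longrightarrow> (\<And>z. z \<in> sphere 0 1 \<Longrightarrow> r z = poly P z / poly Q z)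
    \<Longrightarrow> disc_rational r"
  unfolding disc_rational_def by blast

lemma disc_rational_imp_circle_rational: "disc_rational r \<Longrightarrow> circle_rational r"
  unfolding disc_rational_def circle_rational_def by (meson sphere_cball subsetD)

lemma disc_rational_linear_combination:
  assumes "disc_rational r" "disc_rational s"
  shows "disc_rational (\<lambda>z. c * r z + d * s z)"
proof -
  obtain P Q P' Q' where PQ: "\<forall>z\<in>cball 0 1. poly Q z \<noteq> 0" "\<forall>z\<in>sphere 0 1. r z = poly P z / poly Q z"
    "\<forall>z\<in>cball 0 1. poly Q' z \<noteq> 0" "\<forall>z\<in>sphere 0 1. s z = poly P' z / poly Q' z"
    using assms unfolding disc_rational_def by blast
  show ?thesis
  proof (rule disc_rationalI[of "Q * Q'" _ "smult c (P * Q') + smult d (P' * Q)"])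
    show "poly (Q * Q') z \<noteq> 0" if "z \<in> cball 0 1" for z
      using PQ that by simp
    show "c * r z + d * s z = poly (smult c (P * Q') + smult d (P' * Q)) z / poly (Q * Q') z"
      if "z \<in> sphere 0 1" for z
    proof -
      have "z \<in> cball 0 1"
        using that by simp
      then have "poly Q z \<noteq> 0" "poly Q' z \<noteq> 0"
        using PQ by blast+
      then show ?thesis
        using PQ that by (simp add: field_simps)
    qed
  qed
qed

text \<open>The finitely many poles stay at a distance from the closed disc, so the Taylor series at
  0 converges at some real point beyond 1, and therefore absolutely on the circle.\<close>

lemma disc_rational_power_series:
  assumes "disc_rational r"
  shows "\<exists>c. summable (\<lambda>n. norm (c n)) \<and> (\<forall>z\<in>sphere 0 1. (\<lambda>n. c n * z ^ n) sums r z)"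
proof -
  obtain P Q where PQ: "\<forall>z\<in>cball 0 1. poly Q z \<noteq> 0" "\<forall>z\<in>sphere 0 1. r z = poly P z / poly Q z"
    using assms unfolding disc_rational_def by blast
  define Z where "Z = norm ` {z. poly Q z = 0}"
  have "Q \<noteq> 0"
    using PQ(1) by (metis centre_in_cball poly_0 zero_le_one)
  then have Z: "finite Z" "\<And>x. x \<in> Z \<Longrightarrow> 1 < x"
    using PQ(1) by (auto simp: Z_def poly_roots_finite not_le [symmetric])
  \<comment> \<open>The element 2 provides a radius when \<open>Q\<close> has no zeros.\<close>
  define \<rho> where "\<rho> = Min (insert 2 Z)"
  have \<rho>: "1 < \<rho>" "\<And>x. x \<in> Z \<Longrightarrow> \<rho> \<le> x"
    using Z by (auto simp: \<rho>_def)
  let ?g = "\<lambda>z. poly P z / poly Q z"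
  have "poly Q z \<noteq> 0" if "z \<in> ball 0 \<rho>" for z
    using \<rho>(2)[of "norm z"] that by (auto simp: Z_def)
  then have hol: "?g holomorphic_on ball 0 \<rho>"
    by (intro holomorphic_intros) auto
  define c where "c n = (deriv ^^ n) ?g 0 / fact n" for n
  have sums: "(\<lambda>n. c n * z ^ n) sums ?g z" if "z \<in> ball 0 \<rho>" for z
    using holomorphic_power_series[OF hol that] by (simp add: c_def)
  have "summable (\<lambda>n. c n * complex_of_real ((1 + \<rho>) / 2) ^ n)"
    using sums[of "complex_of_real ((1 + \<rho>) / 2)"] \<rho>(1) by (auto simp del: of_real_divide intro!: sums_summable)
  then have "summable (\<lambda>n. norm (c n * 1 ^ n))"
    by (rule powser_insidea) (use \<rho>(1) in \<open>simp del: of_real_divide\<close>)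
  moreover have "(\<lambda>n. c n * z ^ n) sums r z" if "z \<in> sphere 0 1" for z
    using sums[of z] \<rho>(1) PQ(2) that by simp
  ultimately show ?thesis
    by auto
qed

lemma has_sum_int_extend:
  fixes f :: "nat \<Rightarrow> 'a::{comm_monoid_add, topological_space}"
  assumes "(f has_sum x) UNIV" "\<And>n. g (int n) = f n" "\<And>k. k < 0 \<Longrightarrow> g k = 0"
  shows "(g has_sum x) UNIV"
proof -
  have "g \<circ> int = f"
    using assms(2) by auto
  then have "(g has_sum x) (range int)"
    using assms(1) by (simp add: has_sum_reindex)
  moreover have "(g has_sum x) UNIV \<longleftrightarrow> (g has_sum x) (range int)"
  proof (rule has_sum_cong_neutral)
    fix k
    assume "k \<in> UNIV - range int"
    then show "g k = 0"
      using assms(3) by (metis DiffE not_le rangeI zero_le_imp_eq_int)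
  qed auto
  ultimately show ?thesis
    by simp
qed

lemma disc_rational_fourier:
  assumes "disc_rational r"
  shows "\<exists>c. (\<lambda>n. norm (c n)) summable_on UNIV \<and> (\<forall>n<0. c n = 0) \<and>
    (\<forall>z\<in>sphere 0 1. ((\<lambda>n. z powi n * c n) has_sum r z) (UNIV :: int set))"
proof -
  obtain c where c: "summable (\<lambda>n. norm (c n))" "\<And>z. z \<in> sphere 0 1 \<Longrightarrow> (\<lambda>n. c n * z ^ n) sums r z"
    using disc_rational_power_series[OF assms] by blast
  define d where "d n = (if n < 0 then 0 else c (nat n))" for n :: int
  have "((\<lambda>n. norm (c n)) has_sum (\<Sum>n. norm (c n))) UNIV"
    using c(1) by (intro norm_summable_imp_has_sum) (auto simp: summable_sums)
  then have "((\<lambda>n. norm (d n)) has_sum (\<Sum>n. norm (c n))) UNIV"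
    by (rule has_sum_int_extend) (auto simp: d_def)
  moreover have "((\<lambda>n. z powi n * d n) has_sum r z) UNIV" if z: "z \<in> sphere 0 1" for z
  proof -
    have "((\<lambda>n. c n * z ^ n) has_sum r z) UNIV"
      using c z by (intro norm_summable_imp_has_sum) (auto simp: norm_mult norm_power)
    then show ?thesis
      by (rule has_sum_int_extend) (auto simp: d_def)
  qed
  ultimately show ?thesis
    by (intro exI[of _ d]) (auto simp: d_def summable_on_def)
qed

lemma summable_on_finite_sum:
  fixes g :: "'i \<Rightarrow> 'a \<Rightarrow> real"
  assumes "finite I" "\<And>i. i \<in> I \<Longrightarrow> g i summable_on A"
  shows "(\<lambda>n. \<Sum>i\<in>I. g i n) summable_on A"
  using assms by (induction I rule: finite_induct) (auto intro: summable_on_add)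

text \<open>Reduction to entries: the operator norm is at most the sum of the moduli of the entries,
  and convergence of matrices is entrywise.\<close>

lemma fourier_expansionI:
  fixes c :: "int \<Rightarrow> complex ^ 'n ^ 'n"
  assumes "\<And>i j. (\<lambda>n. norm (c n $ i $ j)) summable_on UNIV"
    and "\<And>z i j. z \<in> sphere 0 1 \<Longrightarrow> ((\<lambda>n. z powi n * c n $ i $ j) has_sum f z $ i $ j) UNIV"
  shows "fourier_expansion f c"
proof -
  have bound: "onorm ((*v) A) \<le> (\<Sum>i\<in>UNIV. \<Sum>j\<in>UNIV. norm (A $ i $ j))" for A :: "complex ^ 'n ^ 'n"
  proof (rule onorm_le)
    fix x :: "complex ^ 'n"
    have "norm (A *v x) \<le> (\<Sum>i\<in>UNIV. norm ((A *v x) $ i))"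
      by (simp add: norm_vec_def L2_set_le_sum)
    also have "\<dots> \<le> (\<Sum>i\<in>UNIV. \<Sum>j\<in>UNIV. norm (A $ i $ j) * norm x)"
    proof (rule sum_mono)
      fix i
      have "norm ((A *v x) $ i) \<le> (\<Sum>j\<in>UNIV. norm (A $ i $ j * x $ j))"
        by (simp add: matrix_vector_mult_def norm_sum)
      also have "\<dots> \<le> (\<Sum>j\<in>UNIV. norm (A $ i $ j) * norm x)"
        by (intro sum_mono) (simp add: norm_mult mult_left_mono Finite_Cartesian_Product.norm_nth_le)
      finally show "norm ((A *v x) $ i) \<le> (\<Sum>j\<in>UNIV. norm (A $ i $ j) * norm x)" .
    qed
    finally show "norm (A *v x) \<le> (\<Sum>i\<in>UNIV. \<Sum>j\<in>UNIV. norm (A $ i $ j)) * norm x"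
      by (simp add: sum_distrib_right)
  qed
  have "(\<lambda>n. \<Sum>i\<in>UNIV. \<Sum>j\<in>UNIV. norm (c n $ i $ j)) summable_on UNIV"
    by (rule summable_on_finite_sum[OF finite], rule summable_on_finite_sum[OF finite], rule assms(1))
  then have "(\<lambda>n. onorm ((*v) (c n))) summable_on UNIV"
    by (rule summable_on_comparison_test) (simp_all add: bound onorm_pos_le)
  moreover have "((\<lambda>n. mat (z powi n) ** c n) has_sum f z) UNIV" if z: "z \<in> sphere 0 1" for z
  proof -
    have "(mat (z powi n) ** c n) $ i $ j = z powi n * c n $ i $ j" for n i j
      by (simp add: matrix_matrix_mult_def mat_def if_distrib if_distribR cong: if_cong)
    then show ?thesis
      using assms(2)[OF z] unfolding has_sum_def
      by (intro vec_tendstoI) simp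
  qed
  ultimately show ?thesis
    unfolding fourier_expansion_def by blast
qed

lemma disc_rational_matrix_fourier:
  fixes h :: "complex \<Rightarrow> complex ^ 'n ^ 'n"
  assumes "\<And>i j. disc_rational (\<lambda>z. h z $ i $ j)"
  shows "\<exists>c. (\<forall>n<0. c n = 0) \<and> (\<forall>i j. (\<lambda>n. norm (c n $ i $ j)) summable_on UNIV) \<and>
    (\<forall>z\<in>sphere 0 1. \<forall>i j. ((\<lambda>n. z powi n * c n $ i $ j) has_sum h z $ i $ j) UNIV)"
proof -
  have "\<forall>i j. \<exists>c. (\<lambda>n. norm (c n)) summable_on UNIV \<and> (\<forall>n<0. c n = 0) \<and>
    (\<forall>z\<in>sphere 0 1. ((\<lambda>n. z powi n * c n) has_sum h z $ i $ j) (UNIV :: int set))"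
    by (intro allI disc_rational_fourier assms)
  then obtain c where "\<forall>i j. (\<lambda>n. norm (c i j n)) summable_on UNIV \<and> (\<forall>n<0. c i j n = 0) \<and>
    (\<forall>z\<in>sphere 0 1. ((\<lambda>n. z powi n * c i j n) has_sum h z $ i $ j) (UNIV :: int set))"
    unfolding choice_iff by blast
  then show ?thesis
    by (intro exI[of _ "\<lambda>n. \<chi> i j. c i j n"]) (auto simp: vec_eq_iff)
qed

lemma disc_rational_wiener_plus:
  fixes h :: "complex \<Rightarrow> complex ^ 'n ^ 'n"
  assumes "\<And>i j. disc_rational (\<lambda>z. h z $ i $ j)"
  shows "h \<in> wiener_plus"
proof -
  obtain c where c: "\<forall>n<0. c n = 0" "\<And>i j. (\<lambda>n. norm (c n $ i $ j)) summable_on UNIV"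
    "\<And>z i j. z \<in> sphere 0 1 \<Longrightarrow> ((\<lambda>n. z powi n * c n $ i $ j) has_sum h z $ i $ j) UNIV"
    using disc_rational_matrix_fourier[OF assms] by blast
  have "fourier_expansion h c"
    by (rule fourier_expansionI) (rule c(2), rule c(3))
  then show ?thesis
    using c(1) unfolding wiener_plus_def by blast
qed

text \<open>On the circle \<open>cnj (z powi n)\<close> is \<open>z powi (- n)\<close>, so taking
  adjoints reflects the Fourier indices.\<close>

lemma disc_rational_wiener_minus:
  fixes h :: "complex \<Rightarrow> complex ^ 'n ^ 'n"
  assumes "\<And>i j. disc_rational (\<lambda>z. h z $ i $ j)"
  shows "(\<lambda>z. mat_adjoint (h z)) \<in> wiener_minus"
proof -
  obtain c where c: "\<forall>n<0. c n = 0" "\<And>i j. (\<lambda>n. norm (c n $ i $ j)) summable_on UNIV"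
    "\<And>z i j. z \<in> sphere 0 1 \<Longrightarrow> ((\<lambda>n. z powi n * c n $ i $ j) has_sum h z $ i $ j) UNIV"
    using disc_rational_matrix_fourier[OF assms] by blast
  define d where "d n = mat_adjoint (c (- n))" for n
  have bij: "bij_betw uminus UNIV (UNIV :: int set)"
    by (rule bij_uminus)
  have "fourier_expansion (\<lambda>z. mat_adjoint (h z)) d"
  proof (rule fourier_expansionI)
    show "(\<lambda>n. norm (d n $ i $ j)) summable_on UNIV" for i j
      using summable_on_reindex_bij_betw[OF bij, of "\<lambda>n. norm (c n $ j $ i)"] c(2) by (simp add: d_def)
    show "((\<lambda>n. z powi n * d n $ i $ j) has_sum mat_adjoint (h z) $ i $ j) UNIV"
      if z: "z \<in> sphere 0 1" for z i j
    proof -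
      have "((\<lambda>n. cnj (z powi n * c n $ j $ i)) has_sum cnj (h z $ j $ i)) UNIV"
        unfolding has_sum_cnj_iff by (rule c(3)[OF z])
      then have "((\<lambda>n. cnj (z powi (- n) * c (- n) $ j $ i)) has_sum cnj (h z $ j $ i)) UNIV"
        using has_sum_reindex_bij_betw[OF bij, of "\<lambda>n. cnj (z powi n * c n $ j $ i)"] by simp
      moreover have "cnj (z powi (- n)) = z powi n" for n
        by (simp add: cnj_unit_circle[OF z] power_int_minus power_int_inverse)
      ultimately show ?thesis
        by (simp add: d_def)
    qed
  qed
  moreover have "\<forall>n>0. d n = 0"
    using c(1) by (simp add: d_def vec_eq_iff)
  ultimately show ?thesis
    unfolding wiener_minus_def by blast
qed

section \<open>Spectral factorization without symmetry\<close>

text \<open>\<open>matrix_inv\<close> is a choice, but uniqueness of inverses identifies it with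
  \<open>k\<close> on the circle, and Fourier expansions depend on nothing else. A one-sided inverse
  suffices for square matrices.\<close>

lemma with_inverse_in_wiener:
  fixes h k :: "complex \<Rightarrow> complex ^ 'n ^ 'n"
  assumes h: "\<And>i j. disc_rational (\<lambda>z. h z $ i $ j)" and k: "\<And>i j. disc_rational (\<lambda>z. k z $ i $ j)"
    and inv: "\<And>z. z \<in> sphere 0 1 \<Longrightarrow> h z ** k z = mat 1"
  shows "with_inverse_in h wiener_plus" "with_inverse_in (\<lambda>z. mat_adjoint (h z)) wiener_minus"
proof -
  have unique: "invertible A \<and> matrix_inv A = B" if "A ** B = mat 1" for A B :: "complex ^ 'n ^ 'n"
  proof -
    have BA: "B ** A = mat 1"
      using that matrix_left_right_inverse by blast
    then have "invertible A"
      using that unfolding invertible_def by blast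
    moreover have "matrix_inv A ** A = mat 1"
      unfolding matrix_inv_def by (rule someI2[of _ B]) (use that BA in auto)
    then have "matrix_inv A = B"
      by (metis that matrix_mul_assoc matrix_mul_lid matrix_mul_rid)
    ultimately show ?thesis
      by blast
  qed
  have adj: "mat_adjoint (h z) ** mat_adjoint (k z) = mat 1" if "z \<in> sphere 0 1" for z
    using inv[OF that] by (metis mat_adjoint_mat_1 mat_adjoint_mult matrix_left_right_inverse)
  have cong: "fourier_expansion f c \<longleftrightarrow> fourier_expansion g c"
    if "\<And>z. z \<in> sphere 0 1 \<Longrightarrow> f z = g z" for f g :: "complex \<Rightarrow> complex ^ 'n ^ 'n" and c
    using that by (simp add: fourier_expansion_def)
  have "(\<lambda>z. matrix_inv (h z)) \<in> wiener_plus"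
  proof -
    have "fourier_expansion (\<lambda>z. matrix_inv (h z)) c \<longleftrightarrow> fourier_expansion k c" for c
      by (rule cong) (use unique[OF inv] in simp)
    then show ?thesis
      using disc_rational_wiener_plus[OF k] by (simp add: wiener_plus_def)
  qed
  then show "with_inverse_in h wiener_plus"
    using disc_rational_wiener_plus[OF h] unique[OF inv] by (simp add: with_inverse_in_def)
  have "(\<lambda>z. matrix_inv (mat_adjoint (h z))) \<in> wiener_minus"
  proof -
    have "fourier_expansion (\<lambda>z. matrix_inv (mat_adjoint (h z))) c
        \<longleftrightarrow> fourier_expansion (\<lambda>z. mat_adjoint (k z)) c" for c
      by (rule cong) (use unique[OF adj] in simp)
    then show ?thesis
      using disc_rational_wiener_minus[OF k] by (simp add: wiener_minus_def)
  qed
  then show "with_inverse_in (\<lambda>z. mat_adjoint (h z)) wiener_minus"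
    using disc_rational_wiener_minus[OF h] unique[OF adj] by (simp add: with_inverse_in_def)
qed

text \<open>Cramer's rule for each unit vector gives the columns of the inverse. For a polynomial
  matrix this shows that \<open>det\<close> is a common denominator of the inverse.\<close>

lemma det_cofactor_inverse:
  fixes A :: "complex ^ 'n ^ 'n"
  assumes "det A \<noteq> 0"
  shows "A ** (\<chi> k j. det (\<chi> a b. if b = k then of_bool (a = j) else A $ a $ b) / det A) = mat 1"
proof -
  let ?B = "\<chi> k j. det (\<chi> a b. if b = k then of_bool (a = j) else A $ a $ b) / det A"
  have "(A ** ?B) $ i $ j = mat 1 $ i $ j" for i j
  proof -
    have "A *v (\<chi> k. det (\<chi> a b. if b = k then of_bool (a = j) else A $ a $ b) / det A)
        = (\<chi> a. of_bool (a = j))"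
      using cramer[OF assms, of _ "\<chi> a. of_bool (a = j)"] unfolding vec_lambda_beta by blast
    then have "(A *v (\<chi> k. ?B $ k $ j)) $ i = of_bool (i = j)"
      by simp
    then show ?thesis
      by (simp add: matrix_matrix_mult_def matrix_vector_mult_def mat_def)
  qed
  then show ?thesis
    by (simp add: vec_eq_iff)
qed

text \<open>The denominator of \<open>h\<close> is \<open>q\<close> and that of \<open>k\<close> is
  \<open>det M\<close>, so both have to be made zero-free in the closed disc without changing the
  Gram matrix or the modulus of \<open>q\<close> on the circle.\<close>

lemma spectral_factorization:
  fixes F :: "complex \<Rightarrow> complex ^ 'n ^ 'n"
  assumes "rational_on_circle F" "\<And>z. z \<in> sphere 0 1 \<Longrightarrow> pos_def (F z)"
  shows "\<exists>(h :: complex \<Rightarrow> complex ^ 'n ^ 'n) (k :: complex \<Rightarrow> complex ^ 'n ^ 'n).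
    (\<forall>i j. disc_rational (\<lambda>z. h z $ i $ j)) \<and> (\<forall>i j. disc_rational (\<lambda>z. k z $ i $ j)) \<and>
    (\<forall>z\<in>sphere 0 1. h z ** k z = mat 1 \<and> F z = mat_adjoint (h z) ** h z)"
proof -
  obtain M0 q0 where M0: "\<forall>z\<in>sphere 0 1. poly q0 z \<noteq> 0 \<and> poly (det M0) z \<noteq> 0 \<and>
    (\<forall>i j. F z $ i $ j = (mat_adjoint (poly_matrix M0 z) ** poly_matrix M0 z) $ i $ j / (cnj (poly q0 z) * poly q0 z))"
    using rational_square_root[OF assms] by blast
  obtain M where M: "\<forall>z\<in>cball 0 1. poly (det M) z \<noteq> 0"
    "\<forall>z\<in>sphere 0 1. mat_adjoint (poly_matrix M z) ** poly_matrix M z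
        = mat_adjoint (poly_matrix M0 z) ** poly_matrix M0 z"
    using zero_free_in_disc[of M0] M0 by blast
  \<comment> \<open>As a matrix of size 1, the denominator falls under
    \<open>zero_free_in_disc\<close>.\<close>
  define q1 :: "complex poly ^ 1 ^ 1" where "q1 = (\<chi> i j. q0)"
  have "det q1 = q0"
    by (simp add: det_1 q1_def)
  then obtain q' :: "complex poly ^ 1 ^ 1" where q': "\<forall>z\<in>cball 0 1. poly (det q') z \<noteq> 0"
    "\<forall>z\<in>sphere 0 1. mat_adjoint (poly_matrix q' z) ** poly_matrix q' z
        = mat_adjoint (poly_matrix q1 z) ** poly_matrix q1 z"
    using zero_free_in_disc[of q1] M0 by metis
  define q where "q = q' $ 1 $ 1"
  have q: "poly q z \<noteq> 0" if "z \<in> cball 0 1" for z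
    using q'(1) that by (simp add: q_def det_1)
  have qq: "cnj (poly q z) * poly q z = cnj (poly q0 z) * poly q0 z" if "z \<in> sphere 0 1" for z
  proof -
    have "(mat_adjoint (poly_matrix q' z) ** poly_matrix q' z) $ 1 $ 1
        = (mat_adjoint (poly_matrix q1 z) ** poly_matrix q1 z) $ 1 $ 1"
      using q'(2) that by simp
    then show ?thesis
      by (simp add: matrix_matrix_mult_def q_def q1_def)
  qed
  \<comment> \<open>The adjugate of \<open>M\<close>, so \<open>k\<close> below is \<open>q\<close>
    times the adjugate over \<open>det M\<close>.\<close>
  define N where "N k j = det ((\<chi> a b. if b = k then [:of_bool (a = j):] else M $ a $ b) :: complex poly ^ 'n ^ 'n)"
    for k j
  have N: "poly (N k j) z = det (\<chi> a b. if b = k then of_bool (a = j) else poly_matrix M z $ a $ b)" for k j z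
    unfolding N_def poly_det by (intro arg_cong[of _ _ det]) (simp add: vec_eq_iff)
  define h where "h z = (\<chi> i j. poly (M $ i $ j) z / poly q z)" for z
  define k where "k z = (\<chi> i j. poly (q * N i j) z / poly (det M) z)" for z
  have "disc_rational (\<lambda>z. h z $ i $ j)" for i j
    using q by (intro disc_rationalI[of q _ "M $ i $ j"]) (auto simp: h_def)
  moreover have "disc_rational (\<lambda>z. k z $ i $ j)" for i j
    using M(1) by (intro disc_rationalI[of "det M" _ "q * N i j"]) (auto simp: k_def)
  moreover have "h z ** k z = mat 1" if z: "z \<in> sphere 0 1" for z
  proof -
    have zc: "z \<in> cball 0 1"
      using z by simp
    have "det (poly_matrix M z) \<noteq> 0"
      using M(1) zc by (metis poly_det)
    then have "poly_matrix M z ** (\<chi> i j. poly (N i j) z / poly (det M) z) = mat 1"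
      unfolding N poly_det by (rule det_cofactor_inverse)
    moreover have "h z ** k z = poly_matrix M z ** (\<chi> i j. poly (N i j) z / poly (det M) z)"
      using q[OF zc] by (simp add: vec_eq_iff matrix_matrix_mult_def h_def k_def)
    ultimately show ?thesis
      by simp
  qed
  moreover have "F z = mat_adjoint (h z) ** h z" if z: "z \<in> sphere 0 1" for z
  proof -
    have "F z $ i $ j = (mat_adjoint (h z) ** h z) $ i $ j" for i j
    proof -
      have "F z $ i $ j
          = (mat_adjoint (poly_matrix M z) ** poly_matrix M z) $ i $ j / (cnj (poly q z) * poly q z)"
        using M0 M(2) z by (simp add: qq[OF z])
      then show ?thesis
        by (simp add: matrix_matrix_mult_def h_def sum_divide_distrib)
    qed
    then show ?thesis
      by (simp add: vec_eq_iff)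
  qed
  ultimately show ?thesis
    by blast
qed

text \<open>The form of \<open>transpose A\<close> at \<open>x\<close> is the form of
  \<open>A\<close> at the conjugate vector.\<close>

lemma pos_def_transpose:
  assumes "pos_def A"
  shows "pos_def (transpose A)"
proof -
  have "0 < Re (\<Sum>i\<in>UNIV. cnj (x $ i) * (transpose A *v x) $ i)" if "x \<noteq> 0" for x
  proof -
    define y where "y = (\<chi> i. cnj (x $ i))"
    have "y \<noteq> 0"
      using that by (auto simp: y_def vec_eq_iff)
    then have "0 < Re (\<Sum>i\<in>UNIV. cnj (y $ i) * (A *v y) $ i)"
      using assms by (simp add: pos_def_def)
    also have "(\<Sum>i\<in>UNIV. cnj (y $ i) * (A *v y) $ i) = (\<Sum>i\<in>UNIV. \<Sum>j\<in>UNIV. x $ i * (A $ i $ j * cnj (x $ j)))"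
      by (simp add: y_def matrix_vector_mult_def sum_distrib_left)
    also have "\<dots> = (\<Sum>i\<in>UNIV. cnj (x $ i) * (transpose A *v x) $ i)"
      by (subst sum.swap) (simp add: matrix_vector_mult_def transpose_def sum_distrib_left mult_ac)
    finally show ?thesis .
  qed
  then show ?thesis
    using assms unfolding pos_def_def by (simp add: vec_eq_iff transpose_def)
qed

text \<open>Transposition reverses products and keeps entries analytic in the disc. The adjoint
  would not serve, as it fixes \<open>mat_adjoint (h z) ** h z\<close>.\<close>

lemma left_spectral_factorization:
  fixes F :: "complex \<Rightarrow> complex ^ 'n ^ 'n"
  assumes "rational_on_circle F" "\<And>z. z \<in> sphere 0 1 \<Longrightarrow> pos_def (F z)"
  shows "\<exists>(h :: complex \<Rightarrow> complex ^ 'n ^ 'n) (k :: complex \<Rightarrow> complex ^ 'n ^ 'n).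
    (\<forall>i j. disc_rational (\<lambda>z. h z $ i $ j)) \<and> (\<forall>i j. disc_rational (\<lambda>z. k z $ i $ j)) \<and>
    (\<forall>z\<in>sphere 0 1. h z ** k z = mat 1 \<and> F z = h z ** mat_adjoint (h z))"
proof -
  have "rational_on_circle (\<lambda>z. transpose (F z))"
    using assms(1) by (simp add: rational_on_circle_def transpose_def)
  then obtain h k :: "complex \<Rightarrow> complex ^ 'n ^ 'n" where hk: "\<And>i j. disc_rational (\<lambda>z. h z $ i $ j)" "\<And>i j. disc_rational (\<lambda>z. k z $ i $ j)"
    "\<And>z. z \<in> sphere 0 1 \<Longrightarrow> h z ** k z = mat 1"
    "\<And>z. z \<in> sphere 0 1 \<Longrightarrow> transpose (F z) = mat_adjoint (h z) ** h z"
    using spectral_factorization[of "\<lambda>z. transpose (F z)", OF _ pos_def_transpose[OF assms(2)]] by blast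
  have "transpose (h z) ** transpose (k z) = mat 1" if "z \<in> sphere 0 1" for z
    using hk(3)[OF that] by (metis matrix_left_right_inverse matrix_transpose_mul transpose_mat)
  moreover have "F z = transpose (h z) ** mat_adjoint (transpose (h z))" if "z \<in> sphere 0 1" for z
  proof -
    have "F z = transpose (mat_adjoint (h z) ** h z)"
      using hk(4)[OF that] by (metis transpose_transpose)
    also have "\<dots> = transpose (h z) ** transpose (mat_adjoint (h z))"
      by (rule matrix_transpose_mul)
    also have "transpose (mat_adjoint (h z)) = mat_adjoint (transpose (h z))"
      by (simp add: vec_eq_iff transpose_def)
    finally show ?thesis .
  qed
  ultimately show ?thesis
    using hk(1,2)
    by - (rule exI[of _ "\<lambda>z. transpose (h z)"], rule exI[of _ "\<lambda>z. transpose (k z)"],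
      simp add: transpose_def)
qed

section \<open>Decomposition along the eigenspaces of \<open>J\<close>\<close>

lemma kronecker_mult: "kronecker A B ** kronecker C D = kronecker (A ** C) (B ** D)"
  for A C :: "'a::comm_ring_1 ^ 'm ^ 'm" and B D :: "'a ^ 'n ^ 'n"
proof -
  have "(\<Sum>x\<in>UNIV. f (fst x) * g (snd x)) = (\<Sum>a\<in>UNIV. f a) * (\<Sum>b\<in>UNIV. g b)"
    for f :: "'m \<Rightarrow> 'a" and g :: "'n \<Rightarrow> 'a"
    by (simp add: sum_product sum.cartesian_product split_beta UNIV_Times_UNIV [symmetric] del: UNIV_Times_UNIV)
  from this[of "\<lambda>a. A $ i $ a * C $ a $ j" "\<lambda>b. B $ k $ b * D $ b $ l" for i j k l]
  show ?thesis
    by (simp add: vec_eq_iff kronecker_def matrix_matrix_mult_def mult_ac)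
qed

text \<open>The orthogonal projection of \<open>\<complex>\<^sup>2\<close> onto the eigenspace of \<^const>\<open>J\<close> for the eigenvalue \<open>c = \<plusminus>\<i>\<close>.\<close>

definition eigenproj :: "complex \<Rightarrow> complex ^ 2 ^ 2" where
  "eigenproj c = vector [vector [1/2, c/2], vector [-c/2, 1/2]]"

lemma eigenproj_rules:
  "eigenproj \<i> ** eigenproj \<i> = eigenproj \<i>"
  "eigenproj (-\<i>) ** eigenproj (-\<i>) = eigenproj (-\<i>)"
  "eigenproj \<i> ** eigenproj (-\<i>) = 0"
  "eigenproj (-\<i>) ** eigenproj \<i> = 0"
  "mat_adjoint (eigenproj \<i>) = eigenproj \<i>"
  "mat_adjoint (eigenproj (-\<i>)) = eigenproj (-\<i>)"
  "eigenproj \<i> + eigenproj (-\<i>) = mat 1"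
  "J ** eigenproj c ** mat_adjoint J = eigenproj c"
  by (simp_all add: vec_eq_iff forall_2 eigenproj_def J_def matrix_matrix_mult_def sum_2 vector_2 mat_def)

text \<open>Acts as \<open>A\<close> and \<open>B\<close> on the two eigenspaces of
  \<open>Jp\<close>. Projections in place of a change of basis make products and adjoints blockwise
  at once.\<close>

definition eigenblocks :: "complex ^ 'p ^ 'p \<Rightarrow> complex ^ 'p ^ 'p \<Rightarrow> complex ^ (2 \<times> 'p::finite) ^ (2 \<times> 'p)" where
  "eigenblocks A B = kronecker (eigenproj \<i>) A + kronecker (eigenproj (-\<i>)) B"

lemma kronecker_zero_left: "kronecker 0 B = 0" for B :: "'a::comm_ring_1 ^ 'n ^ 'm"
  by (simp add: kronecker_def vec_eq_iff)

lemma matrix_add_rdistrib: "(A + B) ** C = A ** C + B ** C" for A B :: "'a::semiring_1 ^ 'm ^ 'n"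
  by (simp add: vec_eq_iff matrix_matrix_mult_def distrib_right sum.distrib)

lemma eigenblocks_mult: "eigenblocks A B ** eigenblocks C D = eigenblocks (A ** C) (B ** D)"
  by (simp add: eigenblocks_def matrix_add_ldistrib matrix_add_rdistrib kronecker_mult eigenproj_rules
      kronecker_zero_left)

lemma mat_adjoint_add: "mat_adjoint (A + B) = mat_adjoint A + mat_adjoint B"
  by (simp add: vec_eq_iff)

lemma mat_adjoint_kronecker: "mat_adjoint (kronecker A B) = kronecker (mat_adjoint A) (mat_adjoint B)"
  by (simp add: vec_eq_iff kronecker_def)

lemma mat_adjoint_eigenblocks: "mat_adjoint (eigenblocks A B) = eigenblocks (mat_adjoint A) (mat_adjoint B)"
  by (simp add: eigenblocks_def mat_adjoint_add mat_adjoint_kronecker eigenproj_rules)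

lemma eigenblocks_one: "eigenblocks (mat 1) (mat 1) = mat 1"
proof -
  have eq: "eigenblocks A A = kronecker (mat 1) A" for A :: "complex ^ 'p ^ 'p"
    by (simp add: eigenproj_rules(7) [symmetric] eigenblocks_def kronecker_def vec_eq_iff distrib_right)
  show ?thesis
    unfolding eq by (auto simp: kronecker_def vec_eq_iff mat_def prod_eq_iff)
qed

text \<open>\<open>J\<close> is unitary and commutes with its spectral projections. As the blocks
  are arbitrary, symmetry of the factors is automatic, however the blocks are factored.\<close>

lemma sharp_eigenblocks: "sharp (eigenblocks A B) = eigenblocks A B"
  by (simp add: sharp_def Jp_def eigenblocks_def matrix_add_ldistrib matrix_add_rdistrib
      mat_adjoint_kronecker kronecker_mult eigenproj_rules)

lemma disc_rational_eigenblocks: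
  assumes "\<And>i j. disc_rational (\<lambda>z. A z $ i $ j)" "\<And>i j. disc_rational (\<lambda>z. B z $ i $ j)"
  shows "disc_rational (\<lambda>z. eigenblocks (A z) (B z) $ x $ y)"
  unfolding eigenblocks_def kronecker_def
  using disc_rational_linear_combination[OF assms] by simp

text \<open>The eigenvectors of \<open>Jp\<close> for \<open>c = \<plusminus>\<i>\<close> are the
  pairs \<open>(x, - c x)\<close>; this is the first component of \<open>M\<close> applied to
  them.\<close>

definition eigenblock :: "complex \<Rightarrow> complex ^ (2 \<times> 'p::finite) ^ (2 \<times> 'p) \<Rightarrow> complex ^ 'p ^ 'p" where
  "eigenblock c M = (\<chi> a b. M $ (1, a) $ (1, b) - c * M $ (1, a) $ (2, b))"

text \<open>Conjugation by \<open>Jp\<close> exchanges the diagonal blocks, and the off-diagonal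
  ones with a change of sign.\<close>

lemma sharp_symmetric_blocks:
  fixes M :: "complex ^ (2 \<times> 'p::finite) ^ (2 \<times> 'p)"
  assumes "M = sharp M"
  shows "M $ (2, a) $ (2, b) = M $ (1, a) $ (1, b)" "M $ (2, a) $ (1, b) = - M $ (1, a) $ (2, b)"
proof -
  have left: "(Jp ** M) $ (i, a) $ y = (\<Sum>k\<in>UNIV. J $ i $ k * M $ (k, a) $ y)" for i a y
  proof -
    have "(Jp ** M) $ (i, a) $ y = (\<Sum>k\<in>UNIV. \<Sum>b\<in>UNIV. J $ i $ k * mat 1 $ a $ b * M $ (k, b) $ y)"
      by (simp add: Jp_def kronecker_def matrix_matrix_mult_def sum.cartesian_product split_beta
          UNIV_Times_UNIV [symmetric] del: UNIV_Times_UNIV)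
    then show ?thesis
      by (simp add: mat_def if_distrib if_distribR cong: if_cong)
  qed
  have right: "(X ** mat_adjoint Jp) $ x $ (j, b) = (\<Sum>k\<in>UNIV. X $ x $ (k, b) * cnj (J $ j $ k))"
    for X :: "complex ^ (2 \<times> 'p) ^ (2 \<times> 'p)" and x j b
  proof -
    have "(X ** mat_adjoint Jp) $ x $ (j, b)
        = (\<Sum>k\<in>UNIV. \<Sum>a\<in>UNIV. X $ x $ (k, a) * (cnj (J $ j $ k) * cnj (mat 1 $ b $ a)))"
      by (simp add: Jp_def mat_adjoint_kronecker kronecker_def matrix_matrix_mult_def sum.cartesian_product split_beta
          UNIV_Times_UNIV [symmetric] del: UNIV_Times_UNIV)
    then show ?thesis
      by (simp add: mat_def if_distrib if_distribR cong: if_cong)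
  qed
  have "M $ (i, a) $ (j, b) = (\<Sum>l\<in>UNIV. (\<Sum>k\<in>UNIV. J $ i $ k * M $ (k, a) $ (l, b)) * cnj (J $ j $ l))"
    for i j a b
    by (subst assms) (simp only: sharp_def left right)
  from this[of 2 a 2 b] this[of 2 a 1 b]
  show "M $ (2, a) $ (2, b) = M $ (1, a) $ (1, b)" "M $ (2, a) $ (1, b) = - M $ (1, a) $ (2, b)"
    by (simp_all add: J_def sum_2)
qed

lemma eigenblocks_of_sharp_symmetric:
  assumes "M = sharp M"
  shows "M = eigenblocks (eigenblock \<i> M) (eigenblock (-\<i>) M)"
proof -
  note blocks = sharp_symmetric_blocks[OF assms]
  have "M $ (i, a) $ (j, b) = eigenblocks (eigenblock \<i> M) (eigenblock (-\<i>) M) $ (i, a) $ (j, b)" for i a j b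
    using exhaust_2[of i] exhaust_2[of j]
    by (auto simp: eigenblocks_def eigenblock_def kronecker_def eigenproj_def blocks field_simps)
  then show ?thesis
    by (simp add: vec_eq_iff)
qed

text \<open>Lifting \<open>x\<close> to the eigenvector \<open>(x, - c x)\<close> of
  \<open>Jp\<close> makes the form of \<open>M\<close> twice that of the block. The conditions on
  \<open>c\<close> treat both imaginary units at once.\<close>

lemma pos_def_eigenblock:
  assumes "M = sharp M" "pos_def M" and c: "c * c = -1" "cnj c = - c"
  shows "pos_def (eigenblock c M)"
proof -
  note blocks = sharp_symmetric_blocks[OF assms(1)]
  let ?F = "eigenblock c M"
  have "mat_adjoint ?F = ?F"
    using pos_def_cnj_nth[OF assms(2)] by (simp add: vec_eq_iff eigenblock_def c blocks)
  moreover have "0 < Re (\<Sum>a\<in>UNIV. cnj (x $ a) * (?F *v x) $ a)" if "x \<noteq> 0" for x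
  proof -
    define y :: "complex ^ (2 \<times> _)" where "y = (\<chi> i. (if fst i = 1 then 1 else - c) * x $ snd i)"
    have y: "y $ (1, a) = x $ a" "y $ (2, a) = - c * x $ a" for a
      by (simp_all add: y_def)
    have "y \<noteq> 0"
      using that y(1) by (metis vec_eq_iff zero_index)
    then have pos: "0 < Re (\<Sum>i\<in>UNIV. cnj (y $ i) * (M *v y) $ i)"
      using assms(2) by (simp add: pos_def_def)
    have split: "(\<Sum>i\<in>UNIV. g i) = (\<Sum>a\<in>UNIV. g (1, a)) + (\<Sum>a\<in>UNIV. g (2, a))"
      for g :: "2 \<times> _ \<Rightarrow> complex"
      unfolding UNIV_Times_UNIV [symmetric] sum.cartesian_product' sum_2 ..
    have My1: "(M *v y) $ (1, a) = (?F *v x) $ a" for a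
      by (simp add: matrix_vector_mult_def split y eigenblock_def sum.distrib [symmetric] algebra_simps)
    have My2: "(M *v y) $ (2, a) = - c * (?F *v x) $ a" for a
    proof -
      have cc: "- q * t + p * (- c * t) = - c * ((p - c * q) * t)" for p q t
      proof -
        have "- c * ((p - c * q) * t) = (c * c) * (q * t) + p * (- c * t)"
          by (simp add: algebra_simps)
        then show ?thesis
          by (simp add: c(1))
      qed
      have "(M *v y) $ (2, a)
          = (\<Sum>b\<in>UNIV. - M $ (1, a) $ (2, b) * x $ b + M $ (1, a) $ (1, b) * (- c * x $ b))"
        by (simp only: matrix_vector_mult_def vec_lambda_beta split y blocks sum.distrib)
      also have "\<dots> = - c * (?F *v x) $ a"
        unfolding cc by (simp add: matrix_vector_mult_def eigenblock_def sum_distrib_left)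
      finally show ?thesis .
    qed
    have cc: "cnj (- c * s) * (- c * t) = cnj s * t" for s t
    proof -
      have "cnj (- c * s) * (- c * t) = - (c * c) * (cnj s * t)"
        by (simp add: c(2))
      then show ?thesis
        by (simp add: c(1))
    qed
    have "(\<Sum>i\<in>UNIV. cnj (y $ i) * (M *v y) $ i) = 2 * (\<Sum>a\<in>UNIV. cnj (x $ a) * (?F *v x) $ a)"
      unfolding split My1 My2 y cc by simp
    then show ?thesis
      using pos by simp
  qed
  ultimately show ?thesis
    unfolding pos_def_def by blast
qed

lemma rational_on_circle_eigenblock:
  assumes "rational_on_circle f"
  shows "rational_on_circle (\<lambda>z. eigenblock c (f z))"
  using assms unfolding rational_on_circle_iff eigenblock_def
  by (auto intro!: circle_rational_diff circle_rational_mult circle_rational_const)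

text \<open>In the right and the left factorization alike, the minus factor is the adjoint of the
  plus factor, so this covers all four factors.\<close>

lemma eigenblocks_factor:
  fixes h1 h2 k1 k2 :: "complex \<Rightarrow> complex ^ 'p ^ 'p"
  assumes "\<And>i j. disc_rational (\<lambda>z. h1 z $ i $ j)" "\<And>i j. disc_rational (\<lambda>z. k1 z $ i $ j)"
    "\<And>i j. disc_rational (\<lambda>z. h2 z $ i $ j)" "\<And>i j. disc_rational (\<lambda>z. k2 z $ i $ j)"
    and inv: "\<And>z. z \<in> sphere 0 1 \<Longrightarrow> h1 z ** k1 z = mat 1" "\<And>z. z \<in> sphere 0 1 \<Longrightarrow> h2 z ** k2 z = mat 1"
  defines "h \<equiv> \<lambda>z. eigenblocks (h1 z) (h2 z)"
  shows "rational_on_circle h" "bicomplex_sharp_symmetric h" "with_inverse_in h wiener_plus"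
    "rational_on_circle (\<lambda>z. mat_adjoint (h z))" "bicomplex_sharp_symmetric (\<lambda>z. mat_adjoint (h z))"
    "with_inverse_in (\<lambda>z. mat_adjoint (h z)) wiener_minus"
proof -
  define k where "k z = eigenblocks (k1 z) (k2 z)" for z
  have h: "disc_rational (\<lambda>z. h z $ i $ j)" for i j
    unfolding h_def by (intro disc_rational_eigenblocks assms)
  have k: "disc_rational (\<lambda>z. k z $ i $ j)" for i j
    unfolding k_def by (intro disc_rational_eigenblocks assms)
  have hk: "h z ** k z = mat 1" if "z \<in> sphere 0 1" for z
    using inv that by (simp add: h_def k_def eigenblocks_mult eigenblocks_one)
  show "rational_on_circle h" "rational_on_circle (\<lambda>z. mat_adjoint (h z))"
    using disc_rational_imp_circle_rational[OF h]
    by (auto simp: rational_on_circle_iff intro: circle_rational_cnj)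
  show "bicomplex_sharp_symmetric h" "bicomplex_sharp_symmetric (\<lambda>z. mat_adjoint (h z))"
    by (simp_all add: bicomplex_sharp_symmetric_def h_def mat_adjoint_eigenblocks sharp_eigenblocks)
  show "with_inverse_in h wiener_plus" "with_inverse_in (\<lambda>z. mat_adjoint (h z)) wiener_minus"
    using with_inverse_in_wiener[of h k] h k hk by blast+
qed

section \<open>Assembling the symmetric factorizations from those of the blocks\<close>

theorem theorem4p13:
  fixes f :: "complex \<Rightarrow> complex ^ (2 \<times> 'p::finite) ^ (2 \<times> 'p)"
  assumes "f \<in> wiener"
    and "rational_on_circle f"
    and "bicomplex_sharp_symmetric f"
    and "\<forall>z\<in>sphere 0 1. pos_def (f z)"
  shows "(\<exists>f_minus f_plus.
            rational_on_circle f_plus \<and> bicomplex_sharp_symmetric f_plus \<and>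
            with_inverse_in f_plus wiener_plus \<and>
            rational_on_circle f_minus \<and> bicomplex_sharp_symmetric f_minus \<and>
            with_inverse_in f_minus wiener_minus \<and>
            (\<forall>z\<in>sphere 0 1. f z = f_minus z ** f_plus z)) \<and>
         (\<exists>g_plus g_minus.
            rational_on_circle g_plus \<and> bicomplex_sharp_symmetric g_plus \<and>
            with_inverse_in g_plus wiener_plus \<and>
            rational_on_circle g_minus \<and> bicomplex_sharp_symmetric g_minus \<and>
            with_inverse_in g_minus wiener_minus \<and>
            (\<forall>z\<in>sphere 0 1. f z = g_plus z ** g_minus z))"
proof -
  define F where "F c z = eigenblock c (f z)" for c z
  have sharp: "f z = sharp (f z)" if "z \<in> sphere 0 1" for z
    using assms(3) that unfolding bicomplex_sharp_symmetric_def by blast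
  have f: "f z = eigenblocks (F \<i> z) (F (-\<i>) z)" if "z \<in> sphere 0 1" for z
    unfolding F_def by (rule eigenblocks_of_sharp_symmetric[OF sharp[OF that]])
  have rat: "rational_on_circle (F c)" for c
    unfolding F_def by (rule rational_on_circle_eigenblock[OF assms(2)])
  have pos: "pos_def (F \<i> z)" "pos_def (F (-\<i>) z)" if "z \<in> sphere 0 1" for z
    unfolding F_def using sharp[OF that] assms(4) that by (auto intro!: pos_def_eigenblock)
  obtain h1 k1 :: "complex \<Rightarrow> complex ^ 'p ^ 'p" where 1: "\<And>i j. disc_rational (\<lambda>z. h1 z $ i $ j)" "\<And>i j. disc_rational (\<lambda>z. k1 z $ i $ j)"
    "\<And>z. z \<in> sphere 0 1 \<Longrightarrow> h1 z ** k1 z = mat 1"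
    "\<And>z. z \<in> sphere 0 1 \<Longrightarrow> F \<i> z = mat_adjoint (h1 z) ** h1 z"
    using spectral_factorization[OF rat pos(1)] by blast
  obtain h2 k2 :: "complex \<Rightarrow> complex ^ 'p ^ 'p" where 2: "\<And>i j. disc_rational (\<lambda>z. h2 z $ i $ j)" "\<And>i j. disc_rational (\<lambda>z. k2 z $ i $ j)"
    "\<And>z. z \<in> sphere 0 1 \<Longrightarrow> h2 z ** k2 z = mat 1"
    "\<And>z. z \<in> sphere 0 1 \<Longrightarrow> F (-\<i>) z = mat_adjoint (h2 z) ** h2 z"
    using spectral_factorization[OF rat pos(2)] by blast
  obtain h3 k3 :: "complex \<Rightarrow> complex ^ 'p ^ 'p" where 3: "\<And>i j. disc_rational (\<lambda>z. h3 z $ i $ j)" "\<And>i j. disc_rational (\<lambda>z. k3 z $ i $ j)"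
    "\<And>z. z \<in> sphere 0 1 \<Longrightarrow> h3 z ** k3 z = mat 1"
    "\<And>z. z \<in> sphere 0 1 \<Longrightarrow> F \<i> z = h3 z ** mat_adjoint (h3 z)"
    using left_spectral_factorization[OF rat pos(1)] by blast
  obtain h4 k4 :: "complex \<Rightarrow> complex ^ 'p ^ 'p" where 4: "\<And>i j. disc_rational (\<lambda>z. h4 z $ i $ j)" "\<And>i j. disc_rational (\<lambda>z. k4 z $ i $ j)"
    "\<And>z. z \<in> sphere 0 1 \<Longrightarrow> h4 z ** k4 z = mat 1"
    "\<And>z. z \<in> sphere 0 1 \<Longrightarrow> F (-\<i>) z = h4 z ** mat_adjoint (h4 z)"
    using left_spectral_factorization[OF rat pos(2)] by blast
  have "f z = mat_adjoint (eigenblocks (h1 z) (h2 z)) ** eigenblocks (h1 z) (h2 z)" if "z \<in> sphere 0 1" for z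
    using f[OF that] 1(4)[OF that] 2(4)[OF that] by (simp add: mat_adjoint_eigenblocks eigenblocks_mult)
  moreover have "f z = eigenblocks (h3 z) (h4 z) ** mat_adjoint (eigenblocks (h3 z) (h4 z))"
    if "z \<in> sphere 0 1" for z
    using f[OF that] 3(4)[OF that] 4(4)[OF that] by (simp add: mat_adjoint_eigenblocks eigenblocks_mult)
  moreover note eigenblocks_factor[OF 1(1,2) 2(1,2) 1(3) 2(3)] eigenblocks_factor[OF 3(1,2) 4(1,2) 3(3) 4(3)]
  ultimately show ?thesis
    by blast
qed

end
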